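(* The space $\mathcal{S}$ of enumerated semigroups does not have a generic semigroup.
   Context: $\mathcal{S}$ is the closed subspace of $\omega^{\omega\times\omega}$ (product topology, $\omega$ discrete) consisting of all associative binary operations $\cdot:\omega\times\omega\to\omega$, i.e. of all semigroup structures on $\omega$. A semigroup in $\mathcal{S}$ is generic if the set of all members of $\mathcal{S}$ isomorphic to it is comeagre in $\mathcal{S}$. *)

theory Defs
  imports "HOL-Analysis.Analysis"
begin

definition nowhere_dense_in :: "'a topology \<Rightarrow> 'a set \<Rightarrow> bool" where
  "nowhere_dense_in X A \<longleftrightarrow> A \<subseteq> topspace X \<and> X interior_of (X closure_of A) = {}"

definition meagre_in :: "'a topology \<Rightarrow> 'a set \<Rightarrow> bool" where
  "meagre_in X A \<longleftrightarrow> (\<exists>\<N>. countable \<N> \<and> (\<forall>N\<in>\<N>. nowhere_dense_in X N) \<and> A = \<Union>\<N>)"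

definition comeagre_in :: "'a topology \<Rightarrow> 'a set \<Rightarrow> bool" where
  "comeagre_in X A \<longleftrightarrow> A \<subseteq> topspace X \<and> meagre_in X (topspace X - A)"

definition enumerated_semigroups :: "(nat \<times> nat \<Rightarrow> nat) set" where
  "enumerated_semigroups = {m. semigroup (curry m)}"

text \<open>The type-class topology on \<^typ>\<open>nat \<times> nat \<Rightarrow> nat\<close> is the product topology over
  the bare index set \<^typ>\<open>nat \<times> nat\<close>, and the one on \<^typ>\<open>nat\<close> is discrete, so
  this is the subspace topology inherited from the Baire space of all binary operations.\<close>

definition enumerated_semigroup_space :: "(nat \<times> nat \<Rightarrow> nat) topology" where
  "enumerated_semigroup_space = top_of_set enumerated_semigroups"

lemma closed_enumerated_semigroups: "closed enumerated_semigroups"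
proof -
  have cont: "continuous_on UNIV (\<lambda>m. m p)" for p :: "nat \<times> nat"
    by (simp add: continuous_on_product_coordinates)
  have eq: "enumerated_semigroups =
      (\<Inter>a b c i j. {m. m (a, b) = i \<and> m (b, c) = j \<longrightarrow> m (i, c) = m (a, j)})"
    by (auto simp: enumerated_semigroups_def semigroup_def)
  have op: "open {m :: nat \<times> nat \<Rightarrow> nat. m p = k}" for p k
    using open_vimage[OF open_discrete[of "{k}"] cont[of p]] by (simp add: vimage_def)
  have cl: "closed {m :: nat \<times> nat \<Rightarrow> nat. m p = m q}" for p q
    by (rule closed_Collect_eq[OF cont cont])
  show ?thesis
    unfolding eq by (intro closed_INT ballI closed_Collect_imp open_Collect_conj op cl)
qed

definition semigroup_isomorphic :: "(nat \<times> nat \<Rightarrow> nat) \<Rightarrow> (nat \<times> nat \<Rightarrow> nat) \<Rightarrow> bool" where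
  "semigroup_isomorphic m n \<longleftrightarrow> (\<exists>h. bij h \<and> (\<forall>x y. h (m (x, y)) = n (h x, h y)))"

definition generic_semigroup :: "(nat \<times> nat \<Rightarrow> nat) \<Rightarrow> bool" where
  "generic_semigroup m \<longleftrightarrow> m \<in> enumerated_semigroups \<and>
     comeagre_in enumerated_semigroup_space {n \<in> enumerated_semigroups. semigroup_isomorphic m n}"

end

theory Submission
  imports Defs
begin

text \<open>
  Why no isomorphism class is comeagre. Fix a finite alphabet of letters, finitely many relations
  between words over it, an assignment v of natural numbers to the letters, and words w(k), for
  k in a countable index set, together with a letter yes. On the open set U of all semigroup
  operations n in which v satisfies the relations, let T(n, v) be the set of all k such that n
  gives w(k) and yes the same value under v. An isomorphism h from m to n turns T(n, v) into
  T(m, w) with w the assignment v pulled back along h. There are only countably many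
  assignments, so T(n, v) takes only countably many values while n runs through the operations
  isomorphic to m. If these operations formed a comeagre set, U would be covered by countably
  many closed sets T(n, v) = K and countably many nowhere dense sets, and by the Baire category
  theorem some set T(n, v) = K would have interior (\<open>corollary4p3\<close>). So it suffices to choose
  the relations and the words such that no finite piece of a multiplication table that is
  compatible with U decides all the equations w(k) = yes (\<open>no_neighbourhood_decides\<close>).

  A finite piece V of the table of a semigroup, together with the fact that the finitely many
  elements that occur in it are different, is a finite presentation with finitely many
  inequalities. It decides w(k) = yes positively if and only if there is a Thue derivation of
  this equation from V, and negatively if and only if V together with this equation derives an
  equation between two of the different elements: otherwise the presented semigroup can be
  spread over the natural numbers so that it extends V (\<open>presented_semigroup_realisation\<close>).
  Both kinds of derivation can be searched for mechanically, and this leaves room for a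
  diagonal argument in the style of Kleene and Rosser. The relations are those of one fixed
  deterministic stack machine, written as a semigroup presentation: w(k) spells the initial
  configuration with program k, and the relations turn w(k) into the letter yes or into a
  second letter no if the machine halts with that answer (\<open>halting_run_derivation\<close>). They do
  not identify yes with no, since the letters act on configurations and answers in accordance
  with the relations (\<open>machine_relations_consistent\<close>). A program is a nondeterministic word
  processor which may also quote the word w(k) of its own k; the machine tries the possible
  choices one after the other and halts as soon as some run accepts (\<open>query_decided\<close>).

  Given V, let k be the program that looks for a derivation of w(k) = yes from V, and
  simultaneously for a derivation of an equation between two different elements from V together
  with w(k) = yes. In the first case it makes the machine answer no, in the second case yes.
  If V decided w(k) = yes, one of the two searches would succeed, and the machine would halt.
  If it answers no, then V and the machine relations give yes = w(k) = no; if it answers yes,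
  then they give w(k) = yes and hence an equation between different elements. Neither is
  possible in a semigroup of U that extends V, so that V does not decide this equation
  (\<open>undecided_query\<close>).
\<close>

section \<open>Words in a semigroup and Thue congruences\<close>

text \<open>The empty word has no value in a semigroup; 0 is a dummy.\<close>

fun ev :: "(nat \<times> nat \<Rightarrow> nat) \<Rightarrow> ('a \<Rightarrow> nat) \<Rightarrow> 'a list \<Rightarrow> nat" where
  "ev n e [] = 0"
| "ev n e [a] = e a"
| "ev n e (a # b # w) = n (e a, ev n e (b # w))"

lemma ev_Cons: "w \<noteq> [] \<Longrightarrow> ev n e (a # w) = n (e a, ev n e w)"
  by (cases w) auto

lemma enumerated_semigroups_assoc:
  "n \<in> enumerated_semigroups \<Longrightarrow> n (n (a, b), c) = n (a, n (b, c))"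
  by (auto simp: enumerated_semigroups_def semigroup_def)

lemma ev_append:
  assumes "n \<in> enumerated_semigroups" "u \<noteq> []" "w \<noteq> []"
  shows "ev n e (u @ w) = n (ev n e u, ev n e w)"
  using assms(2)
proof (induction u rule: list_nonempty_induct)
  case (single x)
  then show ?case using assms(3) by (simp add: ev_Cons)
next
  case (cons x xs)
  then show ?case by (simp add: ev_Cons enumerated_semigroups_assoc[OF assms(1)])
qed

lemma ev_context:
  assumes n: "n \<in> enumerated_semigroups" and "l \<noteq> []" "r \<noteq> []" and eq: "ev n e l = ev n e r"
  shows "ev n e (u @ l @ w) = ev n e (u @ r @ w)"
proof -
  have "ev n e (l @ w) = ev n e (r @ w)"
    using assms by (cases "w = []") (auto simp: ev_append)
  then show ?thesis
    using assms by (cases "u = []") (auto simp: ev_append)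
qed

lemma ev_map: "w \<noteq> [] \<Longrightarrow> ev n e (map f w) = ev n (e \<circ> f) w"
  by (induction w rule: list_nonempty_induct) (auto simp: ev_Cons)

lemma ev_isomorphism:
  assumes "\<And>x y. h (m (x, y)) = n (h x, h y)" and "w \<noteq> []"
  shows "ev n (h \<circ> e) w = h (ev m e w)"
  using assms(2) by (induction w rule: list_nonempty_induct) (auto simp: ev_Cons assms(1))

definition rewrite :: "('a list \<times> 'a list) set \<Rightarrow> 'a list \<Rightarrow> 'a list \<Rightarrow> bool" where
  "rewrite R x y \<longleftrightarrow> (\<exists>u l r w. (l, r) \<in> R \<union> R\<inverse> \<and> x = u @ l @ w \<and> y = u @ r @ w)"

text \<open>Two words are related if and only if they represent the same element of the semigroup (or
monoid) with presentation R.\<close>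

definition thue :: "('a list \<times> 'a list) set \<Rightarrow> 'a list \<Rightarrow> 'a list \<Rightarrow> bool" where
  "thue R = (rewrite R)\<^sup>*\<^sup>*"

lemma rewrite_sym: "rewrite R x y \<Longrightarrow> rewrite R y x"
  unfolding rewrite_def by blast

lemma thue_refl [simp]: "thue R x x"
  by (simp add: thue_def)

lemma thue_trans [trans]: "thue R x y \<Longrightarrow> thue R y z \<Longrightarrow> thue R x z"
  by (simp add: thue_def)

lemma thue_sym: "thue R x y \<Longrightarrow> thue R y x"
  unfolding thue_def
  by (rule sympD[OF symp_rtranclp]) (auto intro: sympI rewrite_sym)

lemma thue_relation: "(l, r) \<in> R \<Longrightarrow> thue R l r"
  unfolding thue_def rewrite_def
  by (rule r_into_rtranclp, rule exI[of _ "[]"], rule exI[of _ l], rule exI[of _ r],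
      rule exI[of _ "[]"]) simp

lemma thue_context: "thue R x y \<Longrightarrow> thue R (u @ x @ w) (u @ y @ w)"
  unfolding thue_def
proof (induction rule: rtranclp_induct)
  case (step y z)
  then obtain u' l r w' where "(l, r) \<in> R \<union> R\<inverse>" "y = u' @ l @ w'" "z = u' @ r @ w'"
    unfolding rewrite_def by blast
  then have "rewrite R (u @ y @ w) (u @ z @ w)"
    unfolding rewrite_def
    by (intro exI[of _ "u @ u'"] exI[of _ l] exI[of _ r] exI[of _ "w' @ w"]) simp
  then show ?case using step.IH by (rule rtranclp.rtrancl_into_rtrancl[rotated])
qed simp

lemma thue_append:
  assumes "thue R x x'" "thue R y y'" shows "thue R (x @ y) (x' @ y')"
  using thue_context[OF assms(1), of "[]" y] thue_context[OF assms(2), of x' "[]"]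
  by (auto intro: thue_trans)

lemma thue_mono:
  assumes "thue R x y" "R \<subseteq> R'" shows "thue R' x y"
proof -
  have "rewrite R \<le> rewrite R'"
    using assms(2) unfolding rewrite_def by blast
  then show ?thesis
    using assms(1) rtranclp_mono unfolding thue_def by blast
qed

lemma thue_sound:
  assumes n: "n \<in> enumerated_semigroups"
    and R: "\<And>l r. (l, r) \<in> R \<Longrightarrow> l \<noteq> [] \<and> r \<noteq> [] \<and> ev n e l = ev n e r"
    and "thue R x y"
  shows "ev n e x = ev n e y"
  using assms(3) unfolding thue_def
proof (induction rule: rtranclp_induct)
  case (step y z)
  then obtain u l r w where lr: "(l, r) \<in> R \<union> R\<inverse>" "y = u @ l @ w" "z = u @ r @ w"
    unfolding rewrite_def by blast
  then have "l \<noteq> []" "r \<noteq> []" "ev n e l = ev n e r"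
    using R[of l r] R[of r l] by auto
  then show ?case using step.IH lr(2,3) ev_context[OF n, of l r e u w] by simp
qed simp

text \<open>The finitely many prescribed values are matched separately; what remains on both sides is
countably infinite.\<close>

lemma bij_betw_extending_finite:
  fixes A :: "'a set" and B :: "'b set"
  assumes "countable A" "infinite A" "countable B" "infinite B"
    and "finite G" and p: "inj_on p G" "p ` G \<subseteq> A" and q: "inj_on q G" "q ` G \<subseteq> B"
  obtains h where "bij_betw h A B" "\<And>i. i \<in> G \<Longrightarrow> h (p i) = q i"
proof -
  obtain g1 where g1: "bij_betw g1 (A - p ` G) (B - q ` G)"
  proof -
    have "bij_betw (to_nat_on (A - p ` G)) (A - p ` G) UNIV"
      using assms by (intro to_nat_on_infinite) auto
    moreover have "bij_betw (from_nat_into (B - q ` G)) UNIV (B - q ` G)"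
      using assms by (intro bij_betw_from_nat_into) auto
    ultimately show ?thesis using that bij_betw_trans by blast
  qed
  define g0 where "g0 = q \<circ> inv_into G p"
  have g0: "bij_betw g0 (p ` G) (q ` G)"
    unfolding g0_def using p q
    by (intro bij_betw_trans[of _ _ G]) (auto simp: bij_betw_inv_into inj_on_imp_bij_betw)
  define h where "h = (\<lambda>x. if x \<in> p ` G then g0 x else g1 x)"
  have "bij_betw h (p ` G \<union> (A - p ` G)) (q ` G \<union> (B - q ` G))"
  proof (rule bij_betw_combine)
    show "bij_betw h (p ` G) (q ` G)"
      using g0 by (subst bij_betw_cong[of _ _ g0]) (auto simp: h_def)
    show "bij_betw h (A - p ` G) (B - q ` G)"
      using g1 by (subst bij_betw_cong[of _ _ g1]) (auto simp: h_def)
  qed auto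
  moreover have "p ` G \<union> (A - p ` G) = A" "q ` G \<union> (B - q ` G) = B"
    using p q by auto
  moreover have "h (p i) = q i" if "i \<in> G" for i
    using that p by (auto simp: h_def g0_def)
  ultimately show ?thesis using that by metis
qed

text \<open>The semigroup presented by R, transported to the natural numbers in such a way that finitely many
generators sit at prescribed places. Infinitely many generators outside the relations guarantee
that the semigroup is infinite, hence in bijection with the natural numbers. Moving a finite set of
generators to prescribed numbers is what makes the result lie in a given basic open set later.\<close>

lemma presented_semigroup_realisation:
  fixes R :: "('a :: countable list \<times> 'a list) set"
  assumes R: "\<And>l r. (l, r) \<in> R \<Longrightarrow> l \<noteq> [] \<and> r \<noteq> [] \<and> set l \<union> set r \<subseteq> B"
    and B: "infinite (- B)"
    and G: "finite G" "inj_on f G"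
    and sep: "\<And>i j. i \<in> G \<Longrightarrow> j \<in> G \<Longrightarrow> i \<noteq> j \<Longrightarrow> \<not> thue R [i] [j]"
  obtains n e where "n \<in> enumerated_semigroups" "\<And>i. i \<in> G \<Longrightarrow> e i = f i"
    "\<And>x y. x \<noteq> [] \<Longrightarrow> y \<noteq> [] \<Longrightarrow> ev n e x = ev n e y \<longleftrightarrow> thue R x y"
proof -
  define cls where "cls w = Collect (thue R w)" for w
  have cls: "cls x = cls y \<longleftrightarrow> thue R x y" for x y
    unfolding cls_def set_eq_iff mem_Collect_eq
    by (blast intro: thue_refl thue_sym thue_trans)
  define H where "H = cls ` {w. w \<noteq> []}"
  \<comment> \<open>a letter that occurs in no relation is congruent to no other word\<close>
  have isolated: "y = [a]" if "a \<notin> B" "thue R [a] y" for a y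
    using that(2) unfolding thue_def
  proof (induction rule: rtranclp_induct)
    case (step y z)
    then obtain u l r w where lr: "(l, r) \<in> R \<union> R\<inverse>" "[a] = u @ l @ w"
      unfolding rewrite_def by auto
    then have "l \<noteq> []" "set l \<subseteq> B" using R by blast+
    moreover have "set l \<subseteq> {a}" using lr(2) by (metis list.set(1,2) set_append Un_upper1 Un_upper2 subset_trans)
    ultimately show ?case using that(1) by (cases l) auto
  qed simp
  have "inj_on (\<lambda>a. cls [a]) (- B)"
    using isolated cls by (auto simp: inj_on_def)
  then have "infinite ((\<lambda>a. cls [a]) ` (- B))"
    using B finite_image_iff by blast
  then have "infinite H"
    by (rule infinite_super[rotated]) (auto simp: H_def)
  moreover have "countable H"
    unfolding H_def by simp
  moreover have "inj_on (\<lambda>i. cls [i]) G"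
    using sep cls by (auto simp: inj_on_def)
  ultimately obtain h where h: "bij_betw h H (UNIV :: nat set)" "\<And>i. i \<in> G \<Longrightarrow> h (cls [i]) = f i"
    using bij_betw_extending_finite[of H "UNIV :: nat set" G "\<lambda>i. cls [i]" f] G
    by (auto simp: H_def)
  have h_eq: "h (cls x) = h (cls y) \<longleftrightarrow> thue R x y" if "x \<noteq> []" "y \<noteq> []" for x y
    using inj_on_eq_iff[OF bij_betw_imp_inj_on[OF h(1)], of "cls x" "cls y"] that cls
    by (auto simp: H_def)
  have h_surj: "\<exists>w. w \<noteq> [] \<and> k = h (cls w)" for k
  proof -
    have "k \<in> h ` H" using bij_betw_imp_surj_on[OF h(1)] by simp
    then show ?thesis by (auto simp: H_def)
  qed
  \<comment> \<open>multiplication of classes, read off from representatives of the numbers h assigns to them\<close>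
  define rep where "rep k = (SOME w. w \<noteq> [] \<and> k = h (cls w))" for k
  have rep: "rep k \<noteq> []" "h (cls (rep k)) = k" for k
    using someI_ex[OF h_surj[of k]] unfolding rep_def by auto
  define n where "n = (\<lambda>(i, j). h (cls (rep i @ rep j)))"
  have n: "n (h (cls x), h (cls y)) = h (cls (x @ y))" if "x \<noteq> []" "y \<noteq> []" for x y
  proof -
    have "thue R (rep (h (cls v))) v" if "v \<noteq> []" for v
      using rep[of "h (cls v)"] h_eq[of "rep (h (cls v))" v] that by blast
    then have "thue R (rep (h (cls x)) @ rep (h (cls y))) (x @ y)"
      using that by (intro thue_append)
    then show ?thesis
      using h_eq[of "rep (h (cls x)) @ rep (h (cls y))" "x @ y"] rep(1) that by (simp add: n_def)
  qed
  define e where "e a = h (cls [a])" for a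
  have "n \<in> enumerated_semigroups"
  proof -
    have "n (n (i, j), k) = n (i, n (j, k))" for i j k
      using n[of "rep i" "rep j"] n[of "rep i @ rep j" "rep k"] n[of "rep j" "rep k"]
        n[of "rep i" "rep j @ rep k"] by (simp add: rep)
    then show ?thesis by (auto simp: enumerated_semigroups_def semigroup_def)
  qed
  moreover have ev: "ev n e w = h (cls w)" if "w \<noteq> []" for w
    using that
  proof (induction w rule: list_nonempty_induct)
    case (cons x xs)
    then show ?case using n[of "[x]" xs] by (simp add: ev_Cons e_def)
  qed (simp add: e_def)
  ultimately show ?thesis
    by (intro that[of n e]) (simp_all add: e_def h(2) ev h_eq)
qed


section \<open>A stack machine as a semigroup presentation\<close>

text \<open>The machine has deterministic control and nine stacks. Programs are lists of micro operations. The
two parts of the program before and after the program counter are kept on \<open>Done\<close> and \<open>Prog\<close>. The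
stack \<open>Quot\<close> holds the quotation, which is the code of the word that spells the initial
configuration; \<open>Quot2\<close> takes up what has been scanned of it. The stack \<open>Choice\<close> holds the
nondeterministic choices that are still to be made, \<open>Used\<close> those that have been made. Programs work on
the three data stacks: \<open>Lft\<close> and \<open>Rgt\<close> contain a word to the left and to the right of a cursor, and
\<open>Mode\<close> a control symbol. \<open>QPush\<close> and \<open>QPop\<close> put the quotation on \<open>Rgt\<close> and remove it from there.

The letters of the presentation are the pushes of symbols, and the states. A letter of the last type is
either one of these or the name of an element of a multiplication table.\<close>

datatype dreg = Lft | Rgt | Mode
datatype stk = Prog | Done | Quot | Quot2 | Choice | Used | Data dreg
datatype oper = Pop dreg bool | Psh dreg bool | QPush | QPop | Acc bool | End
datatype sym = Bot | Bit bool | Op oper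
datatype state =
    Init | Choose | Skip | Fetch | PopData dreg bool
  | PushScan | PushCopy | PopScan | PopMatch bool | PopRestore | Rewind
  | ResetProg | ResetQuot | Clear dreg | ResetUsed | Increment | ResetCarry | Halt bool
datatype gen = Push stk sym | Fn state
datatype letter = Gen gen | Elem nat

instance dreg :: countable by countable_datatype
instance stk :: countable by countable_datatype
instance oper :: countable by countable_datatype
instance sym :: countable by countable_datatype
instance state :: countable by countable_datatype
instance gen :: countable by countable_datatype
instance letter :: countable by countable_datatype

instance dreg :: finite
proof
  have "(UNIV :: dreg set) = {Lft, Rgt, Mode}" using dreg.exhaust by auto
  then show "finite (UNIV :: dreg set)" by (metis finite.emptyI finite_insert)
qed

instance stk :: finite
proof
  have "(UNIV :: stk set) = {Prog, Done, Quot, Quot2, Choice, Used} \<union> range Data"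
    using stk.exhaust by auto
  then show "finite (UNIV :: stk set)" by (metis finite_Un finite.emptyI finite_insert finite_imageI finite)
qed

instance oper :: finite
proof
  have "(UNIV :: oper set) =
      range (case_prod Pop) \<union> range (case_prod Psh) \<union> range Acc \<union> {QPush, QPop, End}"
    by (auto simp: image_iff) (metis oper.exhaust)
  then show "finite (UNIV :: oper set)" by (metis finite_Un finite.emptyI finite_insert finite_imageI finite)
qed

instance sym :: finite
proof
  have "(UNIV :: sym set) = range Bit \<union> range Op \<union> {Bot}"
    by (auto simp: image_iff) (metis sym.exhaust)
  then show "finite (UNIV :: sym set)" by (metis finite_Un finite.emptyI finite_insert finite_imageI finite)
qed

instance state :: finite
proof
  have "(UNIV :: state set) = range (case_prod PopData) \<union> range PopMatch \<union> range Clear \<union> range Halt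
      \<union> {Init, Choose, Skip, Fetch, PushScan, PushCopy, PopScan, PopRestore, Rewind, ResetProg, ResetQuot, ResetUsed, Increment, ResetCarry}"
    by (auto simp: image_iff) (metis state.exhaust)
  then show "finite (UNIV :: state set)" by (metis finite_Un finite.emptyI finite_insert finite_imageI finite)
qed

instance gen :: finite
proof
  have "(UNIV :: gen set) = range (case_prod Push) \<union> range Fn"
    by (auto simp: image_iff) (metis gen.exhaust)
  then show "finite (UNIV :: gen set)" by (metis finite_Un finite_imageI finite)
qed

text \<open>Positive numbers only, so that 0 is free to serve as an end marker.\<close>

definition code :: "letter \<Rightarrow> nat" where
  "code a = Suc (to_nat a)"

text \<open>A prefix-free binary code, so that sequences of code words can be parsed from the front.\<close>

definition bits :: "nat \<Rightarrow> bool list" where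
  "bits i = replicate i True @ [False]"

definition enc :: "nat list \<Rightarrow> bool list" where
  "enc xs = concat (map bits xs)"

text \<open>The first bit ends up on top.\<close>

definition push_bits :: "stk \<Rightarrow> bool list \<Rightarrow> (stk \<times> sym) list" where
  "push_bits s bs = map (\<lambda>b. (s, Bit b)) (rev bs)"

definition push_word :: "(stk \<times> sym) list \<Rightarrow> gen list" where
  "push_word = map (case_prod Push)"

text \<open>The bottom markers of all stacks, and the code of the last letter of the query. The quotation is
completed by the machine in its state \<open>Init\<close>: since it contains a code of every letter of the
query, the query is too short to spell it out.\<close>

definition prologue :: "(stk \<times> sym) list" where
  "prologue = map (\<lambda>s. (s, Bot)) [Prog, Done, Quot, Quot2, Choice, Used, Data Lft, Data Rgt, Data Mode]
     @ push_bits Quot (bits (code (Gen (Fn Init))))"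

text \<open>The letters of the program are pushed in order, so that \<open>Init\<close> meets the last one first. While it moves
them to \<open>Prog\<close>, it prefixes the quotation with their codes.\<close>

definition query :: "oper list \<Rightarrow> gen list" where
  "query k = push_word (prologue @ map (\<lambda>c. (Done, Op c)) k) @ [Fn Init]"

fun source :: "state \<Rightarrow> stk" where
  "source Init = Done"
| "source Choose = Choice"
| "source Skip = Prog"
| "source Fetch = Prog"
| "source (PopData t b) = Data t"
| "source PushScan = Quot"
| "source PushCopy = Quot2"
| "source PopScan = Quot"
| "source (PopMatch b) = Data Rgt"
| "source PopRestore = Quot2"
| "source Rewind = Done"
| "source ResetProg = Done"
| "source ResetQuot = Quot2"
| "source (Clear t) = Data t"
| "source ResetUsed = Used"
| "source Increment = Choice"
| "source ResetCarry = Used"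
| "source (Halt b) = Done"

fun start_op :: "oper \<Rightarrow> (stk \<times> sym) list \<times> state" where
  "start_op (Pop t b) = ([], PopData t b)"
| "start_op (Psh t b) = ([(Data t, Bit b)], Fetch)"
| "start_op QPush = ([], PushScan)"
| "start_op QPop = ([], PopScan)"
| "start_op (Acc b) = ([], Halt b)"
| "start_op End = ([], Rewind)"

text \<open>A symbol that cannot be on top of the stack in question is treated like a bottom marker.

\<open>Choose\<close> consults the next choice: execute the item at the program counter, or skip it. After an
executed item the program is rewound. Whenever an item fails, or the program or the choices are
exhausted, the states from \<open>ResetProg\<close> on restore everything except for the choice stack, which they
advance to the next choice sequence. All of \<open>Choice\<close> is read as a binary counter with the least
digit on top. The bit that appears on \<open>Mode\<close> in the end is the code of 0.\<close>

fun delta :: "state \<Rightarrow> sym \<Rightarrow> (stk \<times> sym) list \<times> state" where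
  "delta Init x = (case x of
      Op c \<Rightarrow> ((Prog, x) # push_bits Quot (bits (code (Gen (Push Done x)))), Init)
    | _ \<Rightarrow> ((Done, x) # push_bits Quot (enc (map (code \<circ> Gen) (push_word prologue)))
             @ push_bits (Data Mode) (bits 0), Choose))"
| "delta Choose x = (case x of
      Bit b \<Rightarrow> ([(Used, x)], if b then Fetch else Skip)
    | _ \<Rightarrow> ([(Choice, x)], ResetProg))"
| "delta Skip x = (case x of
      Op c \<Rightarrow> ([(Done, x)], if c = End then Choose else Skip)
    | _ \<Rightarrow> ([(Prog, x)], ResetProg))"
| "delta Fetch x = (case x of
      Op c \<Rightarrow> ((Done, x) # fst (start_op c), snd (start_op c))
    | _ \<Rightarrow> ([(Prog, x)], ResetProg))"
| "delta (PopData t b) x = (if x = Bit b then ([], Fetch) else ([(Data t, x)], ResetProg))"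
| "delta PushScan x = (case x of
      Bit b \<Rightarrow> ([(Quot2, x)], PushScan)
    | _ \<Rightarrow> ([(Quot, x)], PushCopy))"
| "delta PushCopy x = (case x of
      Bit b \<Rightarrow> ([(Quot, x), (Data Rgt, x)], PushCopy)
    | _ \<Rightarrow> ([(Quot2, x)], Fetch))"
| "delta PopScan x = (case x of
      Bit b \<Rightarrow> ([(Quot2, x)], PopMatch b)
    | _ \<Rightarrow> ([(Quot, x)], PopRestore))"
| "delta (PopMatch b) x = (if x = Bit b then ([], PopScan) else ([(Data Rgt, x)], ResetProg))"
| "delta PopRestore x = (case x of
      Bit b \<Rightarrow> ([(Quot, x)], PopRestore)
    | _ \<Rightarrow> ([(Quot2, x)], Fetch))"
| "delta Rewind x = (case x of
      Op c \<Rightarrow> ([(Prog, x)], Rewind)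
    | _ \<Rightarrow> ([(Done, x)], Choose))"
| "delta ResetProg x = (case x of
      Op c \<Rightarrow> ([(Prog, x)], ResetProg)
    | _ \<Rightarrow> ([(Done, x)], ResetQuot))"
| "delta ResetQuot x = (case x of
      Bit b \<Rightarrow> ([(Quot, x)], ResetQuot)
    | _ \<Rightarrow> ([(Quot2, x)], Clear Lft))"
| "delta (Clear t) x = (case x of
      Bit b \<Rightarrow> ([], Clear t)
    | _ \<Rightarrow> ([(Data t, x)], case t of Lft \<Rightarrow> Clear Rgt | Rgt \<Rightarrow> Clear Mode | Mode \<Rightarrow> ResetUsed))"
| "delta ResetUsed x = (case x of
      Bit b \<Rightarrow> ([(Choice, x)], ResetUsed)
    | _ \<Rightarrow> ([(Used, x)], Increment))"
| "delta Increment x = (case x of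
      Bit b \<Rightarrow> (if b then ([(Used, Bit False)], Increment) else ([(Choice, Bit True)], ResetCarry))
    | _ \<Rightarrow> ([(Choice, x), (Choice, Bit False)], ResetCarry))"
| "delta ResetCarry x = (case x of
      Bit b \<Rightarrow> ([(Choice, x)], ResetCarry)
    | _ \<Rightarrow> ((Used, x) # push_bits (Data Mode) (bits 0), Choose))"
| "delta (Halt b) x = ([], Halt b)"

definition pushes :: "(stk \<times> sym) list \<Rightarrow> (stk \<Rightarrow> sym list) \<Rightarrow> stk \<Rightarrow> sym list" where
  "pushes = fold (\<lambda>(s, x) S. S(s := x # S s))"

inductive step :: "state \<times> (stk \<Rightarrow> sym list) \<Rightarrow> state \<times> (stk \<Rightarrow> sym list) \<Rightarrow> bool" where
  step: "\<lbrakk>q \<notin> range Halt; S (source q) = x # xs; delta q x = (ps, q')\<rbrakk>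
    \<Longrightarrow> step (q, S) (q', pushes ps (S(source q := xs)))"

abbreviation reach :: "state \<times> (stk \<Rightarrow> sym list) \<Rightarrow> state \<times> (stk \<Rightarrow> sym list) \<Rightarrow> bool" where
  "reach \<equiv> step\<^sup>*\<^sup>*"

text \<open>Pushes on different stacks commute, a state letter that follows a push acts as a transition, and a
halting state absorbs everything to its left.\<close>

definition machine_relations :: "(gen list \<times> gen list) set" where
  "machine_relations =
     {([Push s x, Push t y], [Push t y, Push s x]) |s t x y. s \<noteq> t}
   \<union> {([Push (source q) x, Fn q], push_word ps @ [Fn q']) |q x ps q'.
        q \<notin> range Halt \<and> delta q x = (ps, q')}
   \<union> {([Push s x, Fn (Halt b)], [Fn (Halt b)]) |s x b. True}"

lemma machine_relations_nonempty:
  "(l, r) \<in> machine_relations \<Longrightarrow> l \<noteq> [] \<and> r \<noteq> []"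
  by (auto simp: machine_relations_def)

lemma pushes_append: "pushes (u @ w) S = pushes w (pushes u S)"
  by (simp add: pushes_def)

lemma push_word_append: "push_word (u @ w) = push_word u @ push_word w"
  by (simp add: push_word_def)

text \<open>Pushes on other stacks commute with the last push on the stack s, so the letter that a transition
needs can be brought next to the state letter.\<close>

lemma bring_top_to_end:
  assumes "pushes w (\<lambda>_. []) s = x # xs"
  shows "\<exists>w'. pushes w' (\<lambda>_. []) = (pushes w (\<lambda>_. []))(s := xs) \<and>
    thue machine_relations (push_word w) (push_word w' @ [Push s x])"
  using assms
proof (induction w rule: rev_induct)
  case Nil
  then show ?case by (simp add: pushes_def)
next
  case (snoc a w)
  obtain t y where a: "a = (t, y)" by fastforce
  show ?case
  proof (cases "t = s")
    case True
    with snoc.prems a show ?thesis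
      by (intro exI[of _ w]) (auto simp: pushes_append pushes_def push_word_def)
  next
    case False
    let ?E = "\<lambda>_. []"
    from False snoc.prems a have "pushes w ?E s = x # xs"
      by (simp add: pushes_append) (simp add: pushes_def)
    from snoc.IH[OF this] obtain w' where w': "pushes w' ?E = (pushes w ?E)(s := xs)"
      and th: "thue machine_relations (push_word w) (push_word w' @ [Push s x])" by blast
    have "([Push s x, Push t y], [Push t y, Push s x]) \<in> machine_relations"
      using False by (auto simp: machine_relations_def)
    then have "thue machine_relations (push_word w' @ [Push s x, Push t y] @ [])
        (push_word w' @ [Push t y, Push s x] @ [])"
      by (intro thue_context thue_relation)
    moreover have "thue machine_relations ([] @ push_word w @ [Push t y])
        ([] @ (push_word w' @ [Push s x]) @ [Push t y])"
      using th by (rule thue_context)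
    ultimately have "thue machine_relations (push_word (w @ [a])) (push_word (w' @ [a]) @ [Push s x])"
      unfolding a by (simp add: push_word_def) (erule (1) thue_trans[rotated])
    moreover have "pushes (w' @ [a]) ?E = (pushes (w @ [a]) ?E)(s := xs)"
      using w' False by (auto simp: pushes_append a) (auto simp: pushes_def fun_upd_twist)
    ultimately show ?thesis by blast
  qed
qed

lemma halting_word:
  "thue machine_relations (push_word w @ [Fn (Halt b)]) [Fn (Halt b)]"
proof (induction w rule: rev_induct)
  case Nil
  then show ?case by (simp add: push_word_def)
next
  case (snoc a w)
  obtain t y where a: "a = (t, y)" by fastforce
  have "([Push t y, Fn (Halt b)], [Fn (Halt b)]) \<in> machine_relations"
    by (auto simp: machine_relations_def)
  then have "thue machine_relations (push_word w @ [Push t y, Fn (Halt b)] @ [])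
      (push_word w @ [Fn (Halt b)] @ [])"
    by (intro thue_context thue_relation)
  then have "thue machine_relations (push_word (w @ [a]) @ [Fn (Halt b)]) (push_word w @ [Fn (Halt b)])"
    by (simp add: push_word_def a)
  then show ?case using snoc.IH by (rule thue_trans)
qed

text \<open>Each step of the run is an application of a transition relation, once the letter on top of the stack has
been brought next to the state letter. The halting state finally absorbs what is left.\<close>

lemma halting_run_derivation:
  assumes "reach (q, pushes w (\<lambda>_. [])) (Halt b, T)"
  shows "thue machine_relations (push_word w @ [Fn q]) [Fn (Halt b)]"
  using assms
proof (induction "(q, pushes w (\<lambda>_. []))" arbitrary: q w rule: converse_rtranclp_induct)
  case base
  then show ?case by (simp add: halting_word)
next
  case (step c)
  from step.hyps(1) obtain x xs ps q' where q: "q \<notin> range Halt"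
    and top: "pushes w (\<lambda>_. []) (source q) = x # xs" and d: "delta q x = (ps, q')"
    and c: "c = (q', pushes ps ((pushes w (\<lambda>_. []))(source q := xs)))"
    by (auto elim!: step.cases)
  from bring_top_to_end[OF top] obtain w' where
    w': "pushes w' (\<lambda>_. []) = (pushes w (\<lambda>_. []))(source q := xs)" and
    th: "thue machine_relations (push_word w) (push_word w' @ [Push (source q) x])" by blast
  have "thue machine_relations (push_word w @ [Fn q]) (push_word w' @ [Push (source q) x, Fn q])"
    using thue_context[OF th, of "[]" "[Fn q]"] by simp
  also have "thue machine_relations \<dots> (push_word w' @ (push_word ps @ [Fn q']))"
  proof -
    have "([Push (source q) x, Fn q], push_word ps @ [Fn q']) \<in> machine_relations"
      using q d by (auto simp: machine_relations_def)
    from thue_context[OF thue_relation[OF this], of "push_word w'" "[]"] show ?thesis by simp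
  qed
  also have "thue machine_relations \<dots> [Fn (Halt b)]"
    using step.hyps(3)[of q' "w' @ ps"] by (simp add: c pushes_append push_word_append w')
  finally show ?case .
qed

text \<open>The answer of the run that starts from a configuration; it is unique, since halting configurations have
no successor and all others at most one.\<close>

definition outcome :: "state \<times> (stk \<Rightarrow> sym list) \<Rightarrow> bool option" where
  "outcome c = (if \<exists>T. reach c (Halt True, T) then Some True
     else if \<exists>T. reach c (Halt False, T) then Some False else None)"

lemma outcome_step:
  assumes "step c d" shows "outcome c = outcome d"
proof -
  have fn: "fst c \<notin> range Halt"
    using assms by (auto elim: step.cases)
  have det: "d' = d" if "step c d'" for d'
    using that assms by (auto elim!: step.cases)
  have "reach c (Halt b, T) \<longleftrightarrow> reach d (Halt b, T)" for b T
  proof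
    assume "reach c (Halt b, T)"
    then show "reach d (Halt b, T)"
      by (cases rule: converse_rtranclpE) (use fn det in auto)
  qed (use assms in \<open>rule converse_rtranclp_into_rtranclp\<close>)
  then show ?thesis by (simp add: outcome_def)
qed

lemma outcome_Halt: "outcome (Halt b, S) = Some b"
proof -
  have "reach (Halt b, S) d \<longleftrightarrow> d = (Halt b, S)" for d
    by (auto elim: converse_rtranclpE step.cases)
  then show ?thesis by (cases b) (auto simp: outcome_def)
qed

text \<open>A model of the relations: pushes act on the stacks, and a state letter replaces the stacks by the outcome
of the run that starts from them. The outcome is invariant under steps, which is exactly what the
transition relations demand. Nontermination is an outcome as well, so that the model is total.\<close>

fun act :: "gen \<Rightarrow> (stk \<Rightarrow> sym list) + bool option \<Rightarrow> (stk \<Rightarrow> sym list) + bool option" where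
  "act (Push s x) (Inl S) = Inl (S(s := x # S s))"
| "act (Fn q) (Inl S) = Inr (outcome (q, S))"
| "act g (Inr r) = Inr r"

lemma act_Inr: "fold act w (Inr r) = Inr r"
proof (induction w)
  case (Cons g w)
  then show ?case by (cases g) auto
qed simp

lemma act_push_word: "fold act (push_word ps) (Inl S) = Inl (pushes ps S)"
  by (induction ps arbitrary: S) (auto simp: push_word_def pushes_def)

lemma act_relation:
  assumes "(l, r) \<in> machine_relations" shows "fold act l = fold act r"
proof
  fix om :: "(stk \<Rightarrow> sym list) + bool option"
  show "fold act l om = fold act r om"
  proof (cases om)
    case (Inl S)
    from assms consider
      (comm) s t x y where "s \<noteq> t" "l = [Push s x, Push t y]" "r = [Push t y, Push s x]"
    | (trans) q x ps q' where "q \<notin> range Halt" "delta q x = (ps, q')"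
        "l = [Push (source q) x, Fn q]" "r = push_word ps @ [Fn q']"
    | (halt) s x b where "l = [Push s x, Fn (Halt b)]" "r = [Fn (Halt b)]"
      by (auto simp: machine_relations_def)
    then show ?thesis
    proof cases
      case comm
      then show ?thesis by (simp add: Inl fun_upd_twist)
    next
      case trans
      have "step (q, S(source q := x # S (source q)))
        (q', pushes ps (S(source q := x # S (source q), source q := S (source q))))"
        using trans by (intro step.step) auto
      from outcome_step[OF this] show ?thesis
        by (simp add: Inl trans(3,4) act_push_word)
    next
      case halt
      then show ?thesis by (simp add: Inl outcome_Halt)
    qed
  qed (simp add: act_Inr)
qed

text \<open>In the model, the two halting letters replace any stacks by different answers.\<close>

lemma machine_relations_consistent:
  "\<not> thue machine_relations [Fn (Halt True)] [Fn (Halt False)]"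
proof
  assume "thue machine_relations [Fn (Halt True)] [Fn (Halt False)]"
  then have "fold act [Fn (Halt True)] = fold act [Fn (Halt False)]"
    unfolding thue_def
  proof (induction rule: rtranclp_induct)
    case (step y z)
    then obtain u l r w where "(l, r) \<in> machine_relations \<union> machine_relations\<inverse>"
      "y = u @ l @ w" "z = u @ r @ w"
      unfolding rewrite_def by blast
    moreover from this(1) have "fold act l = fold act r"
      using act_relation by fastforce
    ultimately show ?case using step.IH by simp
  qed simp
  from fun_cong[OF this, of "Inl (\<lambda>_. [])"] show False
    by (simp add: outcome_Halt)
qed


section \<open>Execution of programs by the machine\<close>

text \<open>The configurations that occur are those in which every stack carries its own kind of symbols above a
single bottom marker.\<close>

definition mem :: "oper list \<Rightarrow> oper list \<Rightarrow> bool list \<Rightarrow> bool list \<Rightarrow> bool list \<Rightarrow> bool list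
    \<Rightarrow> (dreg \<Rightarrow> bool list) \<Rightarrow> stk \<Rightarrow> sym list" where
  "mem P D K J C B d = (\<lambda>s. (case s of Prog \<Rightarrow> map Op P | Done \<Rightarrow> map Op D | Quot \<Rightarrow> map Bit K
     | Quot2 \<Rightarrow> map Bit J | Choice \<Rightarrow> map Bit C | Used \<Rightarrow> map Bit B | Data t \<Rightarrow> map Bit (d t)) @ [Bot])"

lemma step_to:
  assumes "S (source q) \<noteq> []" "q \<notin> range Halt" "snd (delta q (hd (S (source q)))) = q'"
    "\<And>s. pushes (fst (delta q (hd (S (source q))))) (S(source q := tl (S (source q)))) s = S' s"
  shows "step (q, S) (q', S')"
proof -
  have "S' = pushes (fst (delta q (hd (S (source q))))) (S(source q := tl (S (source q))))"
    using assms(4) by auto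
  with step.step[of q S "hd (S (source q))" "tl (S (source q))"] assms(1-3) show ?thesis
    by (metis list.collapse prod.collapse)
qed

lemma pushes_push_bits:
  "pushes (push_bits s bs) S = S(s := map Bit bs @ S s)"
  by (induction bs arbitrary: S)
    (auto simp: push_bits_def pushes_append, auto simp: pushes_def)

lemma pushes_Cons: "pushes ((s, x) # ps) S = pushes ps (S(s := x # S s))"
  by (simp add: pushes_def)

lemma pushes_Nil: "pushes [] S = S"
  by (simp add: pushes_def)

named_theorems machine_step

lemmas mem_simps = mem_def pushes_Cons pushes_Nil pushes_append pushes_push_bits

lemma step_Init [machine_step]:
  "step (Init, mem P (c # D) K J C B d)
     (Init, mem (c # P) D (bits (code (Gen (Push Done (Op c)))) @ K) J C B d)"
  "step (Init, mem P [] K J C B d)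
     (Choose, mem P [] (enc (map (code \<circ> Gen) (push_word prologue)) @ K) J C B (d(Mode := False # d Mode)))"
  by (rule step_to; auto simp: mem_simps bits_def split: stk.splits)+

lemma step_Choose [machine_step]:
  "step (Choose, mem P D K J (True # C) B d) (Fetch, mem P D K J C (True # B) d)"
  "step (Choose, mem P D K J (False # C) B d) (Skip, mem P D K J C (False # B) d)"
  "step (Choose, mem P D K J [] B d) (ResetProg, mem P D K J [] B d)"
  by (rule step_to; auto simp: mem_simps split: stk.splits)+

lemma step_Skip [machine_step]:
  "step (Skip, mem (c # P) D K J C B d) (if c = End then Choose else Skip, mem P (c # D) K J C B d)"
  "step (Skip, mem [] D K J C B d) (ResetProg, mem [] D K J C B d)"
  by (rule step_to; auto simp: mem_simps split: stk.splits)+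

lemma step_Fetch [machine_step]:
  "step (Fetch, mem (Pop t b # P) D K J C B d) (PopData t b, mem P (Pop t b # D) K J C B d)"
  "step (Fetch, mem (Psh t b # P) D K J C B d) (Fetch, mem P (Psh t b # D) K J C B (d(t := b # d t)))"
  "step (Fetch, mem (QPush # P) D K J C B d) (PushScan, mem P (QPush # D) K J C B d)"
  "step (Fetch, mem (QPop # P) D K J C B d) (PopScan, mem P (QPop # D) K J C B d)"
  "step (Fetch, mem (Acc b # P) D K J C B d) (Halt b, mem P (Acc b # D) K J C B d)"
  "step (Fetch, mem (End # P) D K J C B d) (Rewind, mem P (End # D) K J C B d)"
  "step (Fetch, mem [] D K J C B d) (ResetProg, mem [] D K J C B d)"
  by (rule step_to; auto simp: mem_simps split: stk.splits)+

lemma step_PopData [machine_step]: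
  "d t = b # xs \<Longrightarrow> step (PopData t b, mem P D K J C B d) (Fetch, mem P D K J C B (d(t := xs)))"
  by (rule step_to; auto simp: mem_simps split: stk.splits)

lemma step_PopData_fail [machine_step]:
  "\<nexists>xs. d t = b # xs \<Longrightarrow> step (PopData t b, mem P D K J C B d) (ResetProg, mem P D K J C B d)"
  by (cases "d t") (rule step_to; auto simp: mem_simps split: stk.splits)+

lemma step_quotation [machine_step]:
  "step (PushScan, mem P D (b # K) J C B d) (PushScan, mem P D K (b # J) C B d)"
  "step (PushScan, mem P D [] J C B d) (PushCopy, mem P D [] J C B d)"
  "step (PushCopy, mem P D K (b # J) C B d) (PushCopy, mem P D (b # K) J C B (d(Rgt := b # d Rgt)))"
  "step (PushCopy, mem P D K [] C B d) (Fetch, mem P D K [] C B d)"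
  "step (PopScan, mem P D (b # K) J C B d) (PopMatch b, mem P D K (b # J) C B d)"
  "step (PopScan, mem P D [] J C B d) (PopRestore, mem P D [] J C B d)"
  "step (PopRestore, mem P D K (b # J) C B d) (PopRestore, mem P D (b # K) J C B d)"
  "step (PopRestore, mem P D K [] C B d) (Fetch, mem P D K [] C B d)"
  by (rule step_to; auto simp: mem_simps split: stk.splits)+

lemma step_PopMatch [machine_step]:
  "d Rgt = b # xs \<Longrightarrow> step (PopMatch b, mem P D K J C B d) (PopScan, mem P D K J C B (d(Rgt := xs)))"
  by (rule step_to; auto simp: mem_simps split: stk.splits)

lemma step_PopMatch_fail [machine_step]:
  "\<nexists>xs. d Rgt = b # xs \<Longrightarrow> step (PopMatch b, mem P D K J C B d) (ResetProg, mem P D K J C B d)"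
  by (cases "d Rgt") (rule step_to; auto simp: mem_simps split: stk.splits)+

lemma step_reset [machine_step]:
  "step (Rewind, mem P (c # D) K J C B d) (Rewind, mem (c # P) D K J C B d)"
  "step (Rewind, mem P [] K J C B d) (Choose, mem P [] K J C B d)"
  "step (ResetProg, mem P (c # D) K J C B d) (ResetProg, mem (c # P) D K J C B d)"
  "step (ResetProg, mem P [] K J C B d) (ResetQuot, mem P [] K J C B d)"
  "step (ResetQuot, mem P D K (b # J) C B d) (ResetQuot, mem P D (b # K) J C B d)"
  "step (ResetQuot, mem P D K [] C B d) (Clear Lft, mem P D K [] C B d)"
  "step (ResetUsed, mem P D K J C (b # B) d) (ResetUsed, mem P D K J (b # C) B d)"
  "step (ResetUsed, mem P D K J C [] d) (Increment, mem P D K J C [] d)"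
  "step (Increment, mem P D K J (True # C) B d) (Increment, mem P D K J C (False # B) d)"
  "step (Increment, mem P D K J (False # C) B d) (ResetCarry, mem P D K J (True # C) B d)"
  "step (Increment, mem P D K J [] B d) (ResetCarry, mem P D K J [False] B d)"
  "step (ResetCarry, mem P D K J C (b # B) d) (ResetCarry, mem P D K J (b # C) B d)"
  "step (ResetCarry, mem P D K J C [] d) (Choose, mem P D K J C [] (d(Mode := False # d Mode)))"
  by (rule step_to; auto simp: mem_simps bits_def split: stk.splits)+

lemma step_Clear [machine_step]:
  "d t = b # xs \<Longrightarrow> step (Clear t, mem P D K J C B d) (Clear t, mem P D K J C B (d(t := xs)))"
  "d t = [] \<Longrightarrow> step (Clear t, mem P D K J C B d)
     (case t of Lft \<Rightarrow> Clear Rgt | Rgt \<Rightarrow> Clear Mode | Mode \<Rightarrow> ResetUsed, mem P D K J C B d)"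
  by (rule step_to; auto simp: mem_simps split: stk.splits)+

lemma reach_step: "step x y \<Longrightarrow> reach y z \<Longrightarrow> reach x z"
  by (rule converse_rtranclp_into_rtranclp)

lemma reach_trans: "reach x y \<Longrightarrow> reach y z \<Longrightarrow> reach x z"
  by (rule rtranclp_trans)

lemma reach_Init:
  "reach (Init, mem P D K J C B d)
     (Choose, mem (rev D @ P) []
       (enc (map (code \<circ> Gen) (push_word (prologue @ map (\<lambda>c. (Done, Op c)) (rev D)))) @ K) J C B
       (d(Mode := False # d Mode)))"
proof (induction D arbitrary: P K)
  case Nil
  show ?case
    by (rule r_into_rtranclp) (use step_Init(2) in \<open>simp del: fun_upd_apply o_apply\<close>)
next
  case (Cons c D)
  from reach_step[OF step_Init(1) Cons.IH] show ?case
    by (simp add: push_word_def enc_def del: fun_upd_apply)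
qed

lemma reach_Rewind: "reach (Rewind, mem P D K J C B d) (Choose, mem (rev D @ P) [] K J C B d)"
proof (induction D arbitrary: P)
  case (Cons c D)
  from reach_step[OF step_reset(1) Cons.IH] show ?case by simp
qed (simp add: machine_step r_into_rtranclp)

lemma reach_ResetProg: "reach (ResetProg, mem P D K J C B d) (ResetQuot, mem (rev D @ P) [] K J C B d)"
proof (induction D arbitrary: P)
  case (Cons c D)
  from reach_step[OF step_reset(3) Cons.IH] show ?case by simp
qed (simp add: machine_step r_into_rtranclp)

lemma reach_ResetQuot: "reach (ResetQuot, mem P D K J C B d) (Clear Lft, mem P D (rev J @ K) [] C B d)"
proof (induction J arbitrary: K)
  case (Cons c J)
  from reach_step[OF step_reset(5) Cons.IH] show ?case by simp
qed (simp add: machine_step r_into_rtranclp)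

lemma reach_Clear:
  "reach (Clear t, mem P D K J C B d)
    (case t of Lft \<Rightarrow> Clear Rgt | Rgt \<Rightarrow> Clear Mode | Mode \<Rightarrow> ResetUsed, mem P D K J C B (d(t := [])))"
proof (induction "d t" arbitrary: d)
  case Nil
  then have "d(t := []) = d" by auto
  moreover have "step (Clear t, mem P D K J C B d)
     (case t of Lft \<Rightarrow> Clear Rgt | Rgt \<Rightarrow> Clear Mode | Mode \<Rightarrow> ResetUsed, mem P D K J C B d)"
    using Nil by (intro step_Clear(2)) simp
  ultimately show ?case by (simp only: r_into_rtranclp)
next
  case (Cons b xs)
  have "step (Clear t, mem P D K J C B d) (Clear t, mem P D K J C B (d(t := xs)))"
    by (rule step_Clear(1)) (rule Cons.hyps(2)[symmetric])
  from reach_step[OF this Cons.hyps(1)[of "d(t := xs)"]] show ?case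
    by (simp del: fun_upd_apply) (simp only: fun_upd_same fun_upd_upd simp_thms)
qed

lemma reach_ResetUsed: "reach (ResetUsed, mem P D K J C B d) (Increment, mem P D K J (rev B @ C) [] d)"
proof (induction B arbitrary: C)
  case (Cons c B)
  from reach_step[OF step_reset(7) Cons.IH] show ?case by simp
qed (simp add: machine_step r_into_rtranclp)

lemma reach_ResetCarry:
  "reach (ResetCarry, mem P D K J C B d) (Choose, mem P D K J (rev B @ C) [] (d(Mode := False # d Mode)))"
proof (induction B arbitrary: C)
  case (Cons c B)
  from reach_step[OF step_reset(12) Cons.IH] show ?case by (simp del: fun_upd_apply)
qed (simp add: machine_step r_into_rtranclp)

text \<open>Adding 1 in bijective binary notation, least digit first: in this way every bit list is reached from the
empty one, including those that end in zeros.\<close>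

fun next_choice :: "bool list \<Rightarrow> bool list" where
  "next_choice [] = [False]"
| "next_choice (False # c) = True # c"
| "next_choice (True # c) = False # next_choice c"

lemma reach_Increment:
  "reach (Increment, mem P D K J C B d)
     (Choose, mem P D K J (rev B @ next_choice C) [] (d(Mode := False # d Mode)))"
proof (induction C arbitrary: B rule: next_choice.induct)
  case 1
  show ?case using reach_step[OF step_reset(11) reach_ResetCarry] by (simp del: fun_upd_apply)
next
  case (2 c)
  show ?case using reach_step[OF step_reset(10) reach_ResetCarry] by (simp del: fun_upd_apply)
next
  case (3 c)
  from reach_step[OF step_reset(9) 3] show ?case by (simp del: fun_upd_apply)
qed

text \<open>The data stacks on which every run of a program starts; the bit is the code of the mode 0.\<close>

definition blank :: "dreg \<Rightarrow> bool list" where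
  "blank = (\<lambda>_. [])(Mode := [False])"

text \<open>Failing at any point of a run restores the whole program, the quotation and the choice sequence
from the two halves into which they have been split.\<close>

lemma reach_restart:
  "reach (ResetProg, mem P D K J C B d)
     (Choose, mem (rev D @ P) [] (rev J @ K) [] (next_choice (rev B @ C)) [] blank)"
proof -
  let ?d = "d(Lft := [], Rgt := [], Mode := [])"
  have 1: "reach (ResetProg, mem P D K J C B d) (Clear Lft, mem (rev D @ P) [] (rev J @ K) [] C B d)"
    by (rule reach_trans[OF reach_ResetProg reach_ResetQuot])
  have 2: "reach (Clear Lft, mem (rev D @ P) [] (rev J @ K) [] C B d)
      (ResetUsed, mem (rev D @ P) [] (rev J @ K) [] C B ?d)"
    by (rule reach_trans[OF reach_Clear[of Lft, unfolded dreg.case]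
          reach_trans[OF reach_Clear[of Rgt, unfolded dreg.case] reach_Clear[of Mode, unfolded dreg.case]]])
  have "?d(Mode := False # ?d Mode) = blank"
  proof
    show "(?d(Mode := False # ?d Mode)) t = blank t" for t
      by (cases t) (auto simp: blank_def)
  qed
  then have 3: "reach (Increment, mem (rev D @ P) [] (rev J @ K) [] (rev B @ C) [] ?d)
      (Choose, mem (rev D @ P) [] (rev J @ K) [] (next_choice (rev B @ C)) [] blank)"
    using reach_Increment[of "rev D @ P" "[]" "rev J @ K" "[]" "rev B @ C" "[]" ?d]
    by (simp only: rev.simps append.simps)
  show ?thesis
    by (rule reach_trans[OF 1 reach_trans[OF 2 reach_trans[OF reach_ResetUsed 3]]])
qed

text \<open>The effect of a micro operation on the data stacks, where \<open>\<kappa>\<close> is the quotation; the result None is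
failure. The operations \<open>Acc\<close> and \<open>End\<close> only concern the control, see \<open>plain\<close>.\<close>

fun exec1 :: "bool list \<Rightarrow> oper \<Rightarrow> (dreg \<Rightarrow> bool list) \<Rightarrow> (dreg \<Rightarrow> bool list) option" where
  "exec1 \<kappa> (Pop t b) d =
     (case d t of [] \<Rightarrow> None | x # xs \<Rightarrow> if x = b then Some (d(t := xs)) else None)"
| "exec1 \<kappa> (Psh t b) d = Some (d(t := b # d t))"
| "exec1 \<kappa> QPush d = Some (d(Rgt := \<kappa> @ d Rgt))"
| "exec1 \<kappa> QPop d =
     (if \<exists>ys. d Rgt = \<kappa> @ ys then Some (d(Rgt := drop (length \<kappa>) (d Rgt))) else None)"
| "exec1 \<kappa> c d = None"

fun exec :: "bool list \<Rightarrow> oper list \<Rightarrow> (dreg \<Rightarrow> bool list) \<Rightarrow> (dreg \<Rightarrow> bool list) option" where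
  "exec \<kappa> [] d = Some d"
| "exec \<kappa> (c # cs) d = Option.bind (exec1 \<kappa> c d) (exec \<kappa> cs)"

lemma exec_append: "exec \<kappa> (u @ w) d = Option.bind (exec \<kappa> u d) (exec \<kappa> w)"
  by (induction u arbitrary: d) (auto split: bind_splits)

lemma reach_PushScan: "reach (PushScan, mem P D K J C B d) (PushCopy, mem P D [] (rev K @ J) C B d)"
proof (induction K arbitrary: J)
  case (Cons c K)
  from reach_step[OF step_quotation(1) Cons.IH] show ?case by simp
qed (simp add: machine_step r_into_rtranclp)

lemma reach_PushCopy:
  "reach (PushCopy, mem P D K J C B d) (Fetch, mem P D (rev J @ K) [] C B (d(Rgt := rev J @ d Rgt)))"
proof (induction J arbitrary: K d)
  case (Cons c J)
  have "reach (PushCopy, mem P D (c # K) J C B (d(Rgt := c # d Rgt)))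
      (Fetch, mem P D (rev J @ c # K) [] C B (d(Rgt := rev J @ c # d Rgt)))"
    using Cons.IH[of "c # K" "d(Rgt := c # d Rgt)"] by (simp only: fun_upd_same fun_upd_upd)
  from reach_step[OF step_quotation(3) this] show ?case by (simp del: fun_upd_apply)
qed (simp add: machine_step r_into_rtranclp)

lemma reach_PopRestore: "reach (PopRestore, mem P D K J C B d) (Fetch, mem P D (rev J @ K) [] C B d)"
proof (induction J arbitrary: K)
  case (Cons c J)
  from reach_step[OF step_quotation(7) Cons.IH] show ?case by simp
qed (simp add: machine_step r_into_rtranclp)

lemma reach_PopScan:
  "d Rgt = K @ ys \<Longrightarrow>
    reach (PopScan, mem P D K J C B d) (Fetch, mem P D (rev J @ K) [] C B (d(Rgt := ys)))"
proof (induction K arbitrary: J d)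
  case Nil
  then have "d(Rgt := ys) = d" by auto
  then show ?case using reach_step[OF step_quotation(6) reach_PopRestore] by auto
next
  case (Cons b K)
  have "reach (PopScan, mem P D K (b # J) C B (d(Rgt := K @ ys)))
      (Fetch, mem P D (rev J @ b # K) [] C B (d(Rgt := ys)))"
    using Cons.IH[of "d(Rgt := K @ ys)" "b # J"]
    by (simp only: fun_upd_same fun_upd_upd simp_thms rev.simps append.simps append_assoc)
  moreover have "step (PopMatch b, mem P D K (b # J) C B d) (PopScan, mem P D K (b # J) C B (d(Rgt := K @ ys)))"
    using Cons.prems by (intro step_PopMatch) simp
  ultimately show ?case
    by (blast intro: reach_step step_quotation(5))
qed

text \<open>On a mismatch, part of the quotation has been moved, but nothing of it is lost.\<close>

lemma reach_PopScan_fail: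
  "\<nexists>ys. d Rgt = K @ ys \<Longrightarrow> \<exists>K' J' d'. rev J' @ K' = rev J @ K \<and>
    reach (PopScan, mem P D K J C B d) (ResetProg, mem P D K' J' C B d')"
proof (induction K arbitrary: J d)
  case (Cons b K)
  show ?case
  proof (cases "\<exists>xs. d Rgt = b # xs")
    case True
    then obtain xs where xs: "d Rgt = b # xs" by blast
    with Cons.prems have "\<nexists>ys. (d(Rgt := xs)) Rgt = K @ ys" by auto
    with Cons.IH[of "d(Rgt := xs)" "b # J"] obtain K' J' d' where "rev J' @ K' = rev J @ b # K"
      "reach (PopScan, mem P D K (b # J) C B (d(Rgt := xs))) (ResetProg, mem P D K' J' C B d')"
      by (auto simp del: fun_upd_apply)
    moreover have "step (PopMatch b, mem P D K (b # J) C B d) (PopScan, mem P D K (b # J) C B (d(Rgt := xs)))"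
      using xs by (rule step_PopMatch)
    ultimately have "reach (PopScan, mem P D (b # K) J C B d) (ResetProg, mem P D K' J' C B d')"
      by (blast intro: reach_step step_quotation(5))
    with \<open>rev J' @ K' = rev J @ b # K\<close> show ?thesis by blast
  next
    case False
    have "step (PopMatch b, mem P D K (b # J) C B d) (ResetProg, mem P D K (b # J) C B d)"
      using False by (rule step_PopMatch_fail)
    then have "reach (PopScan, mem P D (b # K) J C B d) (ResetProg, mem P D K (b # J) C B d)"
      by (blast intro: reach_step step_quotation(5))
    then show ?thesis
      by (intro exI[of _ K] exI[of _ "b # J"] exI[of _ d]) auto
  qed
qed simp

definition plain :: "oper \<Rightarrow> bool" where
  "plain c \<longleftrightarrow> c \<noteq> End \<and> c \<notin> range Acc"

lemma reach_exec1:
  assumes "exec1 \<kappa> c d = Some d'"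
  shows "reach (Fetch, mem (c # P) D \<kappa> [] C B d) (Fetch, mem P (c # D) \<kappa> [] C B d')"
proof (cases c)
  case (Pop t b)
  with assms obtain xs where "d t = b # xs" "d' = d(t := xs)"
    by (auto split: list.splits if_splits)
  moreover have "step (PopData t b, mem P (c # D) \<kappa> [] C B d) (Fetch, mem P (c # D) \<kappa> [] C B d')"
    using calculation by (simp only:) (rule step_PopData)
  ultimately show ?thesis
    using Pop by (blast intro: reach_step step_Fetch(1))
next
  case QPush
  then show ?thesis
    using reach_step[OF step_Fetch(3) reach_trans[OF reach_PushScan[of _ _ \<kappa> "[]"] reach_PushCopy]] assms
    by (auto simp del: fun_upd_apply)
next
  case QPop
  with assms obtain ys where "d Rgt = \<kappa> @ ys" "d' = d(Rgt := ys)"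
    by (auto split: if_splits)
  then show ?thesis
    using reach_step[OF step_Fetch(4) reach_PopScan[of d \<kappa> ys _ _ "[]"]] QPop
    by (simp del: fun_upd_apply)
qed (use assms step_Fetch(2) in auto)

lemma reach_exec1_fail:
  assumes "exec1 \<kappa> c d = None" "plain c"
  shows "\<exists>K J d'. rev J @ K = \<kappa> \<and>
    reach (Fetch, mem (c # P) D \<kappa> [] C B d) (ResetProg, mem P (c # D) K J C B d')"
proof (cases c)
  case (Pop t b)
  with assms have "\<nexists>xs. d t = b # xs"
    by (auto split: list.splits if_splits)
  then have "step (PopData t b, mem P (c # D) \<kappa> [] C B d) (ResetProg, mem P (c # D) \<kappa> [] C B d)"
    by (rule step_PopData_fail)
  then have "reach (Fetch, mem (c # P) D \<kappa> [] C B d) (ResetProg, mem P (c # D) \<kappa> [] C B d)"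
    using Pop by (blast intro: reach_step step_Fetch(1))
  then show ?thesis
    by (intro exI[of _ \<kappa>] exI[of _ "[]"]) auto
next
  case QPop
  with assms have "\<nexists>ys. d Rgt = \<kappa> @ ys" by (auto split: if_splits)
  from reach_PopScan_fail[of d \<kappa> "[]" P "c # D" C B, OF this] obtain K J d' where
    "rev J @ K = \<kappa>" "reach (PopScan, mem P (c # D) \<kappa> [] C B d) (ResetProg, mem P (c # D) K J C B d')"
    by auto
  then show ?thesis
    using QPop by (blast intro: reach_step step_Fetch(4))
qed (use assms in \<open>auto simp: plain_def\<close>)

lemma reach_exec:
  "exec \<kappa> cs d = Some d' \<Longrightarrow>
    reach (Fetch, mem (cs @ P) D \<kappa> [] C B d) (Fetch, mem P (rev cs @ D) \<kappa> [] C B d')"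
proof (induction cs arbitrary: d D)
  case (Cons c cs)
  then obtain d1 where d1: "exec1 \<kappa> c d = Some d1" "exec \<kappa> cs d1 = Some d'"
    by (auto split: bind_splits)
  from reach_trans[OF reach_exec1[OF d1(1), of "cs @ P" D C B] Cons.IH[OF d1(2), of "c # D"]]
  show ?case by simp
qed simp

lemma reach_exec_fail:
  "\<lbrakk>exec \<kappa> cs d = None; \<forall>c \<in> set cs. plain c\<rbrakk> \<Longrightarrow>
    \<exists>P' D' K J d'. rev D' @ P' = rev D @ cs @ P \<and> rev J @ K = \<kappa> \<and>
      reach (Fetch, mem (cs @ P) D \<kappa> [] C B d) (ResetProg, mem P' D' K J C B d')"
proof (induction cs arbitrary: d D)
  case (Cons c cs)
  show ?case
  proof (cases "exec1 \<kappa> c d")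
    case None
    have "plain c" using Cons.prems(2) by simp
    from reach_exec1_fail[OF None this, of "cs @ P" D C B] obtain K J d' where "rev J @ K = \<kappa>"
      "reach (Fetch, mem (c # cs @ P) D \<kappa> [] C B d) (ResetProg, mem (cs @ P) (c # D) K J C B d')"
      by blast
    then show ?thesis
      by (intro exI[of _ "cs @ P"] exI[of _ "c # D"]) auto
  next
    case (Some d1)
    with Cons.prems have "exec \<kappa> cs d1 = None" by simp
    from Cons.IH[OF this, of "c # D"] Cons.prems(2) obtain P' D' K J d' where
      "rev D' @ P' = rev D @ (c # cs) @ P" "rev J @ K = \<kappa>"
      "reach (Fetch, mem (cs @ P) (c # D) \<kappa> [] C B d1) (ResetProg, mem P' D' K J C B d')" by auto
    moreover from this(3) have "reach (Fetch, mem ((c # cs) @ P) D \<kappa> [] C B d) (ResetProg, mem P' D' K J C B d')"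
      using reach_trans[OF reach_exec1[OF Some, of "cs @ P" D C B]] by simp
    ultimately show ?thesis by blast
  qed
qed simp

text \<open>An item is a block of micro operations that is executed as a whole. It comes with an answer if its
successful execution accepts.\<close>

type_synonym item = "oper list \<times> bool option"

fun item_code :: "item \<Rightarrow> oper list" where
  "item_code (cs, None) = cs @ [End]"
| "item_code (cs, Some b) = cs @ [Acc b, End]"

definition program :: "item list \<Rightarrow> oper list" where
  "program its = concat (map item_code its)"

definition plain_items :: "item list \<Rightarrow> bool" where
  "plain_items its \<longleftrightarrow> (\<forall>(cs, a) \<in> set its. \<forall>c \<in> set cs. plain c)"

definition item_step :: "bool list \<Rightarrow> item list \<Rightarrow> (dreg \<Rightarrow> bool list) \<Rightarrow> (dreg \<Rightarrow> bool list) \<Rightarrow> bool"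
  where "item_step \<kappa> its d d' \<longleftrightarrow> (\<exists>cs. (cs, None) \<in> set its \<and> exec \<kappa> cs d = Some d')"

definition accepts :: "bool list \<Rightarrow> item list \<Rightarrow> bool \<Rightarrow> bool" where
  "accepts \<kappa> its b \<longleftrightarrow> (\<exists>d d' cs. (item_step \<kappa> its)\<^sup>*\<^sup>* blank d \<and> (cs, Some b) \<in> set its \<and>
     exec \<kappa> cs d = Some d')"

lemma program_append: "program (u @ w) = program u @ program w"
  by (simp add: program_def)

lemma program_Cons: "program (it # its) = item_code it @ program its"
  by (simp add: program_def)

lemma reach_Skip_plain:
  "End \<notin> set cs \<Longrightarrow>
    reach (Skip, mem (cs @ End # P) D K J C B d) (Choose, mem P (End # rev cs @ D) K J C B d)"
proof (induction cs arbitrary: D)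
  case Nil
  show ?case using step_Skip(1)[of End] by auto
next
  case (Cons c cs)
  then have "reach (Skip, mem (cs @ End # P) (c # D) K J C B d)
      (Choose, mem P (End # rev (c # cs) @ D) K J C B d)" by simp
  moreover have "step (Skip, mem (c # cs @ End # P) D K J C B d) (Skip, mem (cs @ End # P) (c # D) K J C B d)"
    using step_Skip(1)[of c "cs @ End # P" D K J C B d] Cons.prems by (auto split: if_splits)
  ultimately show ?case
    using reach_step by simp
qed

lemma reach_Skip:
  assumes "plain_items (it # its)"
  shows "reach (Skip, mem (item_code it @ P) D K J C B d) (Choose, mem P (rev (item_code it) @ D) K J C B d)"
proof -
  obtain cs a where it: "it = (cs, a)" by fastforce
  have "End \<notin> set cs"
    using assms it by (auto simp: plain_items_def plain_def)
  then show ?thesis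
    using reach_Skip_plain[of cs] reach_Skip_plain[of "cs @ [Acc (the a)]"] it
    by (cases a) auto
qed

lemma reach_alternatives:
  assumes "reach x y" and "(\<exists>b T. Q b \<and> reach y (Halt b, T)) \<or> reach y z"
  shows "(\<exists>b T. Q b \<and> reach x (Halt b, T)) \<or> reach x z"
  using assms(2) reach_trans[OF assms(1)] by blast

text \<open>Every run with a given choice sequence is finite, since each item that is executed or skipped
consumes a choice. The position of the program counter and the data stacks have to be generalised for
the induction on the remaining choices.\<close>

lemma halts_or_restarts:
  assumes its: "plain_items its"
  shows "\<lbrakk>its = its1 @ its2; (item_step \<kappa> its)\<^sup>*\<^sup>* blank d\<rbrakk> \<Longrightarrow>
    (\<exists>b T. accepts \<kappa> its b \<and>
      reach (Choose, mem (program its2) (rev (program its1)) \<kappa> [] C B d) (Halt b, T)) \<or>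
    reach (Choose, mem (program its2) (rev (program its1)) \<kappa> [] C B d)
      (Choose, mem (program its) [] \<kappa> [] (next_choice (rev B @ C)) [] blank)"
proof (induction C arbitrary: its1 its2 B d)
  case Nil
  from reach_step[OF step_Choose(3) reach_restart, of "program its2" "rev (program its1)" \<kappa> "[]" B d]
  show ?case
    using Nil.prems(1) by (simp add: program_append)
next
  case (Cons x C)
  show ?case
  proof (cases its2)
    case Nil
    have "\<exists>q. step (Choose, mem [] D \<kappa> [] (x # C) B d) (q, mem [] D \<kappa> [] C (x # B) d) \<and>
        step (q, mem [] D \<kappa> [] C (x # B) d) (ResetProg, mem [] D \<kappa> [] C (x # B) d)" for D
      by (cases x) (auto intro: step_Choose(1,2) step_Skip(2) step_Fetch(7))
    then have "reach (Choose, mem [] D \<kappa> [] (x # C) B d) (ResetProg, mem [] D \<kappa> [] C (x # B) d)" for D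
      by (blast intro: reach_step)
    then have "reach (Choose, mem [] D \<kappa> [] (x # C) B d)
       (Choose, mem (rev D) [] \<kappa> [] (next_choice (rev B @ x # C)) [] blank)" for D
      using reach_trans[OF _ reach_restart[of "[]" D \<kappa> "[]" C "x # B" d]] by simp
    from this[of "rev (program its1)"] show ?thesis
      using Nil Cons.prems by (simp add: program_def)
  next
    case its2: (Cons it its3)
    have p: "program its = program its1 @ item_code it @ program its3"
      using Cons.prems its2 by (simp add: program_append program_Cons)
    have plain: "plain_items (it # its3)"
      using its Cons.prems its2 by (auto simp: plain_items_def)
    show ?thesis
    proof (cases x)
      case False
      have h: "reach (Choose, mem (program its2) (rev (program its1)) \<kappa> [] (x # C) B d)
          (Choose, mem (program its3) (rev (program (its1 @ [it]))) \<kappa> [] C (x # B) d)"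
        using reach_step[OF step_Choose(2) reach_Skip[OF plain],
          of "program its3" "rev (program its1)" \<kappa> "[]" C B d] False
        by (simp add: its2 program_Cons program_append) (simp add: program_def)
      have "its = (its1 @ [it]) @ its3" "rev (x # B) @ C = rev B @ x # C"
        using Cons.prems(1) its2 by simp_all
      with Cons.IH[of "its1 @ [it]" its3 d "x # B"] Cons.prems(2) show ?thesis
        by (intro reach_alternatives[OF h]) simp
    next
      case True
      obtain cs a where it: "it = (cs, a)" by fastforce
      define tl where "tl = (case a of None \<Rightarrow> [End] | Some b \<Rightarrow> [Acc b, End]) @ program its3"
      have code: "program its2 = cs @ tl"
        by (cases a) (auto simp: its2 it program_Cons tl_def)
      have start: "step (Choose, mem (program its2) (rev (program its1)) \<kappa> [] (x # C) B d)
          (Fetch, mem (cs @ tl) (rev (program its1)) \<kappa> [] C (True # B) d)"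
        using step_Choose(1) True code by simp
      have mem_it: "(cs, a) \<in> set its"
        using Cons.prems its2 it by simp
      show ?thesis
      proof (cases "exec \<kappa> cs d")
        case None
        have pl: "\<forall>c \<in> set cs. plain c"
          using plain it by (auto simp: plain_items_def)
        have "program its = program its1 @ cs @ tl"
          using Cons.prems(1) code by (simp add: program_append)
        with reach_exec_fail[OF None pl, of "rev (program its1)" tl C "True # B"]
        obtain P' D' K J d' where
          *: "rev D' @ P' = program its" "rev J @ K = \<kappa>" and
          fail: "reach (Fetch, mem (cs @ tl) (rev (program its1)) \<kappa> [] C (True # B) d)
            (ResetProg, mem P' D' K J C (True # B) d')"
          by auto
        from reach_step[OF start reach_trans[OF fail reach_restart]] show ?thesis
          using * True by simp
      next
        case (Some d')
        note run = reach_step[OF start reach_exec[OF Some, of tl "rev (program its1)" C "True # B"]]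
        show ?thesis
        proof (cases a)
          case None
          have "(item_step \<kappa> its)\<^sup>*\<^sup>* blank d'"
            by (rule rtranclp.rtrancl_into_rtrancl[OF Cons.prems(2)])
              (use mem_it None Some in \<open>auto simp: item_step_def\<close>)
          from Cons.IH[of "[]" its d' "True # B", OF _ this] have
            "(\<exists>b T. accepts \<kappa> its b \<and>
               reach (Choose, mem (program its) [] \<kappa> [] C (True # B) d') (Halt b, T)) \<or>
             reach (Choose, mem (program its) [] \<kappa> [] C (True # B) d')
               (Choose, mem (program its) [] \<kappa> [] (next_choice (rev B @ x # C)) [] blank)"
            using True by (simp add: program_def)
          moreover have h: "reach (Choose, mem (program its2) (rev (program its1)) \<kappa> [] (x # C) B d)
              (Choose, mem (program its) [] \<kappa> [] C (True # B) d')"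
          proof -
            have "tl = End # program its3"
              using None by (simp add: tl_def)
            then have "reach (Fetch, mem tl (rev cs @ rev (program its1)) \<kappa> [] C (True # B) d')
                (Choose, mem (program its) [] \<kappa> [] C (True # B) d')"
              using reach_step[OF step_Fetch(6) reach_Rewind,
                of "program its3" "rev cs @ rev (program its1)" \<kappa> "[]" C "True # B" d'] p it None
              by simp
            with run show ?thesis by (rule reach_trans)
          qed
          ultimately show ?thesis by (intro reach_alternatives[OF h])
        next
          case a: (Some b)
          then have "accepts \<kappa> its b"
            using Cons.prems(2) mem_it Some by (auto simp: accepts_def)
          moreover have "\<exists>T. reach (Choose, mem (program its2) (rev (program its1)) \<kappa> [] (x # C) B d)
              (Halt b, T)"
          proof -
            have "tl = Acc b # End # program its3"
              using a by (simp add: tl_def)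
            then obtain T where
              "step (Fetch, mem tl (rev cs @ rev (program its1)) \<kappa> [] C (True # B) d') (Halt b, T)"
              using step_Fetch(5) by blast
            from rtranclp.rtrancl_into_rtrancl[OF run this] show ?thesis by blast
          qed
          ultimately show ?thesis by blast
        qed
      qed
    qed
  qed
qed

text \<open>To execute the item with a given index, that many choices to skip and one to execute are made.\<close>

lemma reach_choose_item:
  assumes "plain_items its" "its = its1 @ it # its2"
  shows "reach (Choose, mem (program its) [] \<kappa> [] (replicate (length its1) False @ True # C) B d)
    (Fetch, mem (item_code it @ program its2) (rev (program its1)) \<kappa> [] C
       (True # replicate (length its1) False @ B) d)"
proof -
  have "reach (Choose, mem (program (its1 @ r)) D \<kappa> [] (replicate (length its1) False @ C) B d)
      (Choose, mem (program r) (rev (program its1) @ D) \<kappa> [] C (replicate (length its1) False @ B) d)"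
    if "plain_items (its1 @ r)" for r D C
    using that
  proof (induction its1 arbitrary: D B)
    case (Cons it its1)
    have "reach (Choose, mem (program ((it # its1) @ r)) D \<kappa> [] (replicate (length (it # its1)) False @ C) B d)
       (Choose, mem (program (its1 @ r)) (rev (item_code it) @ D) \<kappa> []
         (replicate (length its1) False @ C) (False # B) d)"
      using reach_step[OF step_Choose(2) reach_Skip[of it "its1 @ r"],
        of "program (its1 @ r)" D \<kappa> "[]" "replicate (length its1) False @ C" B d] Cons.prems
      by (simp add: program_Cons)
    moreover have "plain_items (its1 @ r)"
      using Cons.prems by (auto simp: plain_items_def)
    ultimately show ?case
      using reach_trans[OF _ Cons.IH[of "rev (item_code it) @ D" "False # B"]]
      by (simp add: program_Cons replicate_app_Cons_same)
  qed (simp add: program_def)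
  from this[of "it # its2" "[]" "True # C"] assms
  have "reach (Choose, mem (program its) [] \<kappa> [] (replicate (length its1) False @ True # C) B d)
      (Choose, mem (item_code it @ program its2) (rev (program its1)) \<kappa> [] (True # C)
        (replicate (length its1) False @ B) d)"
    by (simp add: program_Cons)
  then show ?thesis
    by (rule rtranclp.rtrancl_into_rtrancl) (rule step_Choose(1))
qed

lemma reach_item_steps:
  assumes its: "plain_items its" and "(item_step \<kappa> its)\<^sup>*\<^sup>* d d'"
  shows "\<exists>c. \<forall>C B. \<exists>B'. reach (Choose, mem (program its) [] \<kappa> [] (c @ C) B d)
    (Choose, mem (program its) [] \<kappa> [] C B' d')"
  using assms(2)
proof (induction rule: rtranclp_induct)
  case base
  show ?case by (intro exI[of _ "[]"]) auto
next
  case (step y z)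
  then obtain cs its1 its2 where ex: "exec \<kappa> cs y = Some z" and its_eq: "its = its1 @ (cs, None) # its2"
    unfolding item_step_def by (metis split_list)
  from step.IH obtain c where c: "\<And>C B. \<exists>B'. reach (Choose, mem (program its) [] \<kappa> [] (c @ C) B d)
    (Choose, mem (program its) [] \<kappa> [] C B' y)" by blast
  let ?r = "replicate (length its1) False"
  have "\<exists>B'. reach (Choose, mem (program its) [] \<kappa> [] ((c @ ?r @ [True]) @ C) B d)
    (Choose, mem (program its) [] \<kappa> [] C B' z)" for C B
  proof -
    obtain B' where 1: "reach (Choose, mem (program its) [] \<kappa> [] (c @ ?r @ True # C) B d)
        (Choose, mem (program its) [] \<kappa> [] (?r @ True # C) B' y)"
      using c by blast
    have 2: "reach (Choose, mem (program its) [] \<kappa> [] (?r @ True # C) B' y)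
        (Fetch, mem (cs @ End # program its2) (rev (program its1)) \<kappa> [] C
       (True # ?r @ B') y)"
      using reach_choose_item[OF its its_eq, of \<kappa> C B' y] by simp
    have 3: "reach (Fetch, mem (End # program its2) (rev cs @ rev (program its1)) \<kappa> [] C
       (True # ?r @ B') z) (Choose, mem (program its) [] \<kappa> [] C (True # ?r @ B') z)"
      using reach_step[OF step_Fetch(6) reach_Rewind, of "program its2" "rev cs @ rev (program its1)"] its_eq
      by (simp add: program_append program_Cons)
    show ?thesis
      using reach_trans[OF 1 reach_trans[OF 2 reach_trans[OF reach_exec[OF ex] 3]]] by auto
  qed
  then have "\<forall>C B. \<exists>B'. reach (Choose, mem (program its) [] \<kappa> [] ((c @ ?r @ [True]) @ C) B d)
    (Choose, mem (program its) [] \<kappa> [] C B' z)" by blast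
  then show ?case by (rule exI[of _ "c @ ?r @ [True]"])
qed

lemma accepting_choice:
  assumes its: "plain_items its" and acc: "accepts \<kappa> its b"
  shows "\<exists>c T. reach (Choose, mem (program its) [] \<kappa> [] c [] blank) (Halt b, T)"
proof -
  from acc obtain d d' cs where d: "(item_step \<kappa> its)\<^sup>*\<^sup>* blank d" "(cs, Some b) \<in> set its"
    and ex: "exec \<kappa> cs d = Some d'" unfolding accepts_def by blast
  then obtain its1 its2 where its_eq: "its = its1 @ (cs, Some b) # its2"
    by (metis split_list)
  from reach_item_steps[OF its d(1)] obtain c where
    c: "\<And>C B. \<exists>B'. reach (Choose, mem (program its) [] \<kappa> [] (c @ C) B blank)
    (Choose, mem (program its) [] \<kappa> [] C B' d)" by blast
  let ?r = "replicate (length its1) False"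
  from c obtain B' where 1: "reach (Choose, mem (program its) [] \<kappa> [] (c @ ?r @ [True]) [] blank)
      (Choose, mem (program its) [] \<kappa> [] (?r @ [True]) B' d)" by blast
  have 2: "reach (Choose, mem (program its) [] \<kappa> [] (?r @ [True]) B' d)
      (Fetch, mem (cs @ Acc b # End # program its2) (rev (program its1)) \<kappa> [] [] (True # ?r @ B') d)"
    using reach_choose_item[OF its its_eq, of \<kappa> "[]" B' d] by simp
  from reach_trans[OF 1 reach_trans[OF 2 rtranclp.rtrancl_into_rtrancl[OF reach_exec[OF ex] step_Fetch(5)]]]
  show ?thesis by blast
qed

fun choice_value :: "bool list \<Rightarrow> nat" where
  "choice_value [] = 0"
| "choice_value (b # c) = (if b then 2 else 1) + 2 * choice_value c"

lemma choice_value_next: "choice_value (next_choice c) = Suc (choice_value c)"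
  by (induction c rule: next_choice.induct) auto

lemma choice_value_inject: "choice_value c = choice_value c' \<Longrightarrow> c = c'"
proof (induction c arbitrary: c')
  case Nil
  then show ?case by (cases c') (auto split: if_splits)
next
  case (Cons b c)
  then obtain b' c'' where c': "c' = b' # c''" by (cases c') (auto split: if_splits)
  have "b = b' \<and> choice_value c = choice_value c''"
    using Cons.prems unfolding c' by (cases b; cases b') (auto, presburger+)
  then show ?case using Cons.IH c' by simp
qed

lemma next_choice_surj: "\<exists>i. (next_choice ^^ i) [] = c"
proof -
  have "choice_value ((next_choice ^^ i) []) = i" for i
    by (induction i) (auto simp: choice_value_next)
  then show ?thesis using choice_value_inject by blast
qed

lemma pushes_query:
  "pushes (prologue @ map (\<lambda>c. (Done, Op c)) k) (\<lambda>_. [])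
    = mem [] (rev k) (bits (code (Gen (Fn Init)))) [] [] [] (\<lambda>_. [])"
proof -
  have "pushes (map (\<lambda>c. (Done, Op c)) k) S = S(Done := map Op (rev k) @ S Done)" for S
    by (induction k arbitrary: S) (auto simp: pushes_Cons pushes_Nil)
  note simps = this prologue_def pushes_append pushes_push_bits pushes_Cons pushes_Nil mem_def
  show ?thesis
  proof
    fix s
    show "pushes (prologue @ map (\<lambda>c. (Done, Op c)) k) (\<lambda>_. []) s
        = mem [] (rev k) (bits (code (Gen (Fn Init)))) [] [] [] (\<lambda>_. []) s"
    proof (cases s)
      case (Data t)
      then show ?thesis by (cases t) (simp_all add: simps)
    qed (simp_all add: simps)
  qed
qed

text \<open>The machine finds an accepting run if there is one, but not necessarily one with the expected answer:
the first accepting run in the order of the choice sequences wins.\<close>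

lemma query_decided:
  assumes its: "plain_items its"
    and \<kappa>: "\<kappa> = enc (map (code \<circ> Gen) (query (program its)))"
    and acc: "accepts \<kappa> its b0"
  shows "\<exists>b. accepts \<kappa> its b \<and> thue machine_relations (query (program its)) [Fn (Halt b)]"
proof -
  let ?ready = "\<lambda>c. (Choose, mem (program its) [] \<kappa> [] c [] blank)"
  let ?start = "(Init, pushes (prologue @ map (\<lambda>c. (Done, Op c)) (program its)) (\<lambda>_. []))"
  have init: "reach ?start (?ready [])"
    using reach_Init[of "[]" "rev (program its)" "bits (code (Gen (Fn Init)))" "[]" "[]" "[]" "\<lambda>_. []"]
    by (simp add: pushes_query \<kappa> query_def blank_def enc_def)
  have "(\<exists>b T. accepts \<kappa> its b \<and> reach ?start (Halt b, T)) \<or> reach ?start (?ready ((next_choice ^^ i) []))"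
    for i
  proof (induction i)
    case 0
    then show ?case using init by simp
  next
    case (Suc i)
    from halts_or_restarts[OF its, of "[]" its \<kappa> blank "(next_choice ^^ i) []" "[]"]
    have "(\<exists>b T. accepts \<kappa> its b \<and> reach (?ready ((next_choice ^^ i) [])) (Halt b, T)) \<or>
      reach (?ready ((next_choice ^^ i) [])) (?ready ((next_choice ^^ Suc i) []))"
      by (simp add: program_def)
    with Suc show ?case using reach_alternatives by blast
  qed
  note alternatives = this
  obtain c T where c: "reach (?ready c) (Halt b0, T)"
    using accepting_choice[OF its acc] by blast
  obtain i where "(next_choice ^^ i) [] = c"
    using next_choice_surj by blast
  with alternatives[of i] consider
    b T where "accepts \<kappa> its b" "reach ?start (Halt b, T)" | "reach ?start (?ready c)"
    by blast
  then obtain b T where "accepts \<kappa> its b" "reach ?start (Halt b, T)"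
    using acc reach_trans[OF _ c] by cases blast+
  with halting_run_derivation show ?thesis
    unfolding query_def by blast
qed


section \<open>Programs that operate on numbers\<close>

lemma bits_prefix: "bits i @ r = bits j @ s \<Longrightarrow> i = j \<and> r = s"
proof (induction i arbitrary: j)
  case 0
  then show ?case by (cases j) (auto simp: bits_def)
next
  case (Suc i)
  then show ?case by (cases j) (auto simp: bits_def)
qed

lemma enc_Nil [simp]: "enc [] = []"
  by (simp add: enc_def)

lemma enc_Cons [simp]: "enc (i # xs) = bits i @ enc xs"
  by (simp add: enc_def)

lemma enc_append [simp]: "enc (xs @ ys) = enc xs @ enc ys"
  by (simp add: enc_def)

lemma enc_prefix: "enc ys = enc xs @ r \<Longrightarrow> \<exists>zs. ys = xs @ zs \<and> r = enc zs"
proof (induction xs arbitrary: ys)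
  case (Cons i xs)
  then obtain j ys' where ys: "ys = j # ys'"
    by (cases ys) (auto simp: bits_def)
  with Cons.prems have "bits j @ enc ys' = bits i @ enc xs @ r" by simp
  from bits_prefix[OF this] Cons.IH ys show ?case by auto
qed simp

text \<open>Operations on stacks of numbers, which are to be compiled to operations on stacks of bits by means of
the prefix-free code.\<close>

datatype wop = WPop dreg nat | WPsh dreg nat | WQPush | WQPop

fun compile1 :: "wop \<Rightarrow> oper list" where
  "compile1 (WPop t i) = map (Pop t) (bits i)"
| "compile1 (WPsh t i) = map (Psh t) (rev (bits i))"
| "compile1 WQPush = [QPush]"
| "compile1 WQPop = [QPop]"

definition compile :: "wop list \<Rightarrow> oper list" where
  "compile ws = concat (map compile1 ws)"

fun wexec1 :: "nat list \<Rightarrow> wop \<Rightarrow> (dreg \<Rightarrow> nat list) \<Rightarrow> (dreg \<Rightarrow> nat list) option" where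
  "wexec1 q (WPop t i) x =
     (case x t of [] \<Rightarrow> None | j # js \<Rightarrow> if j = i then Some (x(t := js)) else None)"
| "wexec1 q (WPsh t i) x = Some (x(t := i # x t))"
| "wexec1 q WQPush x = Some (x(Rgt := q @ x Rgt))"
| "wexec1 q WQPop x =
     (if \<exists>ys. x Rgt = q @ ys then Some (x(Rgt := drop (length q) (x Rgt))) else None)"

fun wexec :: "nat list \<Rightarrow> wop list \<Rightarrow> (dreg \<Rightarrow> nat list) \<Rightarrow> (dreg \<Rightarrow> nat list) option" where
  "wexec q [] x = Some x"
| "wexec q (c # cs) x = Option.bind (wexec1 q c x) (wexec q cs)"

lemma wexec_append: "wexec q (u @ w) x = Option.bind (wexec q u x) (wexec q w)"
  by (induction u arbitrary: x) (auto split: bind_splits)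

lemma exec_pops:
  "exec \<kappa> (map (Pop t) bs) d =
    (if \<exists>ys. d t = bs @ ys then Some (d(t := drop (length bs) (d t))) else None)"
proof (induction bs arbitrary: d)
  case (Cons b bs)
  then show ?case by (cases "d t") (auto simp: fun_upd_def)
qed simp

lemma exec_pushes: "exec \<kappa> (map (Psh t) bs) d = Some (d(t := rev bs @ d t))"
  by (induction bs arbitrary: d) auto

definition encode :: "(dreg \<Rightarrow> nat list) \<Rightarrow> dreg \<Rightarrow> bool list" where
  "encode x = (\<lambda>t. enc (x t))"

lemma encode_apply: "encode x t = enc (x t)"
  by (simp add: encode_def)

lemma encode_fun_upd: "(encode x)(t := enc ys) = encode (x(t := ys))"
  by (auto simp: encode_def)

lemma exec_compile1:
  "exec (enc q) (compile1 c) (encode x) = map_option encode (wexec1 q c x)"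
proof (cases c)
  case (WPop t i)
  show ?thesis
  proof (cases "\<exists>js. x t = i # js")
    case True
    then show ?thesis using WPop
      by (auto simp: exec_pops encode_fun_upd[symmetric] encode_apply)
  next
    case False
    have "\<nexists>ys. enc (x t) = bits i @ ys"
      using enc_prefix[of "x t" "[i]"] False by auto
    then show ?thesis using WPop False by (auto simp: exec_pops encode_apply split: list.splits)
  qed
next
  case (WPsh t i)
  then show ?thesis by (simp add: exec_pushes encode_fun_upd[symmetric] encode_apply)
next
  case WQPush
  then show ?thesis by (auto simp: encode_fun_upd[symmetric] encode_apply)
next
  case WQPop
  show ?thesis
  proof (cases "\<exists>ys. x Rgt = q @ ys")
    case True
    then show ?thesis using WQPop by (auto simp: encode_fun_upd[symmetric] encode_apply)
  next
    case False
    have "\<nexists>ys. enc (x Rgt) = enc q @ ys"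
      using enc_prefix[of "x Rgt" q] False by auto
    then show ?thesis using WQPop False by (auto simp: encode_apply)
  qed
qed

lemma exec_compile:
  "exec (enc q) (compile ws) (encode x) = map_option encode (wexec q ws x)"
proof (induction ws arbitrary: x)
  case (Cons c ws)
  have "exec (enc q) (compile (c # ws)) (encode x)
      = Option.bind (exec (enc q) (compile1 c) (encode x)) (exec (enc q) (compile ws))"
    by (simp add: compile_def exec_append)
  then show ?case
    by (cases "wexec1 q c x") (simp_all add: exec_compile1 Cons.IH)
qed (simp add: compile_def)

definition wstep :: "nat list \<Rightarrow> (wop list \<times> bool option) set \<Rightarrow> (dreg \<Rightarrow> nat list) \<Rightarrow> (dreg \<Rightarrow> nat list) \<Rightarrow> bool"
  where "wstep q I x x' \<longleftrightarrow> (\<exists>ws. (ws, None) \<in> I \<and> wexec q ws x = Some x')"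

definition wblank :: "dreg \<Rightarrow> nat list" where
  "wblank = (\<lambda>_. [])(Mode := [0])"

lemma wblank_simps [simp]: "wblank Mode = [0]" "wblank Lft = []" "wblank Rgt = []"
  by (simp_all add: wblank_def)

definition waccepts :: "nat list \<Rightarrow> (wop list \<times> bool option) set \<Rightarrow> bool \<Rightarrow> bool" where
  "waccepts q I b \<longleftrightarrow>
    (\<exists>x x' ws. (wstep q I)\<^sup>*\<^sup>* wblank x \<and> (ws, Some b) \<in> I \<and> wexec q ws x = Some x')"

lemma blank_wblank: "blank = encode wblank"
  by (auto simp: blank_def wblank_def bits_def fun_eq_iff encode_def)

text \<open>A compiled program fails or succeeds as a whole on an encoded stack, and it leaves an encoded stack
behind. So between two items the bit-level search only sees encoded stacks.\<close>

lemma accepts_iff_waccepts: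
  assumes its: "set its = (\<lambda>(ws, a). (compile ws, a)) ` I"
  shows "accepts (enc q) its b \<longleftrightarrow> waccepts q I b"
proof -
  have ex_its: "(\<exists>cs. (cs, a) \<in> set its \<and> Q cs) \<longleftrightarrow> (\<exists>ws. (ws, a) \<in> I \<and> Q (compile ws))" for a Q
    unfolding its by (force simp: image_iff)
  have one: "item_step (enc q) its (encode x) d \<longleftrightarrow> (\<exists>x'. d = encode x' \<and> wstep q I x x')" for x d
    unfolding item_step_def wstep_def ex_its by (auto simp: exec_compile)
  have steps: "(item_step (enc q) its)\<^sup>*\<^sup>* blank d \<longleftrightarrow> (\<exists>x. d = encode x \<and> (wstep q I)\<^sup>*\<^sup>* wblank x)" for d
  proof
    assume "(item_step (enc q) its)\<^sup>*\<^sup>* blank d"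
    then show "\<exists>x. d = encode x \<and> (wstep q I)\<^sup>*\<^sup>* wblank x"
    proof (induction rule: rtranclp_induct)
      case base
      then show ?case using blank_wblank by blast
    next
      case (step y z)
      then show ?case using one by (metis rtranclp.rtrancl_into_rtrancl)
    qed
  next
    assume "\<exists>x. d = encode x \<and> (wstep q I)\<^sup>*\<^sup>* wblank x"
    then obtain x where d: "d = encode x" and "(wstep q I)\<^sup>*\<^sup>* wblank x" by blast
    from this(2) have "(item_step (enc q) its)\<^sup>*\<^sup>* blank (encode x)"
    proof (induction rule: rtranclp_induct)
      case base
      then show ?case by (simp add: blank_wblank)
    next
      case (step y z)
      then have "item_step (enc q) its (encode y) (encode z)"
        using one by blast
      with step.IH show ?case by (metis rtranclp.rtrancl_into_rtrancl)
    qed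
    then show "(item_step (enc q) its)\<^sup>*\<^sup>* blank d" by (simp add: d)
  qed
  show ?thesis
  proof -
    have "accepts (enc q) its b \<longleftrightarrow>
        (\<exists>x. (wstep q I)\<^sup>*\<^sup>* wblank x \<and> (\<exists>cs. (cs, Some b) \<in> set its \<and> (\<exists>d'. exec (enc q) cs (encode x) = Some d')))"
      unfolding accepts_def steps by blast
    also have "\<dots> \<longleftrightarrow> waccepts q I b"
      unfolding ex_its waccepts_def by (auto simp: exec_compile)
    finally show ?thesis .
  qed
qed

lemma plain_compile: "c \<in> set (compile ws) \<Longrightarrow> plain c"
proof -
  have "c \<in> set (compile1 w) \<Longrightarrow> plain c" for w
    by (cases w) (auto simp: plain_def)
  then show "c \<in> set (compile ws) \<Longrightarrow> plain c"
    by (auto simp: compile_def)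
qed


section \<open>A program that searches for derivations\<close>

definition code_word :: "letter list \<Rightarrow> nat list" where
  "code_word = map code"

lemma code_word_simps [simp]:
  "code_word [] = []" "code_word (a # u) = code a # code_word u"
  "code_word (u @ w) = code_word u @ code_word w"
  by (auto simp: code_word_def)

lemma code_inject [simp]: "code a = code b \<longleftrightarrow> a = b"
  by (simp add: code_def)

lemma code_nonzero [simp]: "code a \<noteq> 0"
  by (simp add: code_def)

abbreviation yes :: letter where "yes \<equiv> Gen (Fn (Halt True))"

text \<open>The program that belongs to a finite presentation R, a finite set G of letters that are supposed to be
different, and a finite set A of letters over which the cursor can move. In mode 0 nothing has happened
yet. In mode 1 the program looks for a derivation from R that starts with the quoted word and ends with
the letter \<open>yes\<close>. In mode 2 it looks for a derivation that leads from i to j for different i and j in G,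
where it may also replace the quoted word by \<open>yes\<close> and vice versa. In this mode j is remembered at the
bottom of the right stack, below the end marker 0.\<close>

definition prover_items ::
  "letter set \<Rightarrow> (letter list \<times> letter list) set \<Rightarrow> letter set \<Rightarrow> (wop list \<times> bool option) set" where
  "prover_items A R G =
     {(map (WPop Rgt) (code_word l) @ map (WPsh Rgt) (rev (code_word r)), None) |l r. (l, r) \<in> R \<union> R\<inverse>}
   \<union> {([WPop Rgt (code a), WPsh Lft (code a)], None) |a. a \<in> A}
   \<union> {([WPop Lft (code a), WPsh Rgt (code a)], None) |a. a \<in> A}
   \<union> {([WPop Mode 2, WQPop, WPsh Rgt (code yes), WPsh Mode 2], None),
      ([WPop Mode 2, WPop Rgt (code yes), WQPush, WPsh Mode 2], None),
      ([WPop Mode 0, WPsh Lft 0, WPsh Rgt 0, WQPush, WPsh Mode 1], None),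
      ([WPop Mode 1, WPop Lft 0, WPop Rgt (code yes), WPop Rgt 0], Some False)}
   \<union> {([WPop Mode 0, WPsh Lft 0, WPsh Rgt (code j), WPsh Rgt 0, WPsh Rgt (code i), WPsh Mode 2], None) |i j.
        i \<in> G \<and> j \<in> G \<and> i \<noteq> j}
   \<union> {([WPop Mode 2, WPop Lft 0, WPop Rgt (code j), WPop Rgt 0, WPop Rgt (code j)], Some True) |j. j \<in> G}"

text \<open>The word \<open>rev l @ r\<close> with the cursor between its two parts, in mode m; the word is delimited by the
marker 0 on both sides, and tail is what is remembered below the right marker.\<close>

definition tape :: "nat \<Rightarrow> letter list \<Rightarrow> letter list \<Rightarrow> nat list \<Rightarrow> dreg \<Rightarrow> nat list" where
  "tape m l r tail t = (case t of Mode \<Rightarrow> [m] | Lft \<Rightarrow> code_word l @ [0] | Rgt \<Rightarrow> code_word r @ 0 # tail)"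

lemma tape_simps [simp]:
  "tape m l r tail Mode = [m]" "tape m l r tail Lft = code_word l @ [0]"
  "tape m l r tail Rgt = code_word r @ 0 # tail"
  by (auto simp: tape_def)

lemma eq_tape_iff: "x = tape m l r tail \<longleftrightarrow>
    x Mode = [m] \<and> x Lft = code_word l @ [0] \<and> x Rgt = code_word r @ 0 # tail"
  by (auto simp: fun_eq_iff) (metis dreg.exhaust tape_simps)

lemma wexec_pops:
  "wexec q (map (WPop t) w) x = Some x' \<longleftrightarrow> (\<exists>ys. x t = w @ ys \<and> x' = x(t := ys))"
proof (induction w arbitrary: x)
  case (Cons i w)
  then show ?case by (cases "x t") (auto simp del: fun_upd_apply simp: fun_upd_same)
qed (auto simp: fun_upd_idem)

lemma wexec_pushes: "wexec q (map (WPsh t) w) x = Some (x(t := rev w @ x t))"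
  by (induction w arbitrary: x) (auto simp del: fun_upd_apply simp: fun_upd_same)

lemma wexec_rule:
  "wexec q (map (WPop t) u @ map (WPsh t) (rev w)) x = Some x' \<longleftrightarrow>
    (\<exists>ys. x t = u @ ys \<and> x' = x(t := w @ ys))"
  by (auto simp: wexec_append wexec_pops wexec_pushes bind_eq_Some_conv)

lemma wexec_Cons [simp]:
  "wexec q (WPop t i # ws) x = Some x' \<longleftrightarrow>
    (\<exists>ys. x t = i # ys \<and> wexec q ws (x(t := ys)) = Some x')"
  "wexec q (WPsh t i # ws) x = wexec q ws (x(t := i # x t))"
  "wexec q (WQPush # ws) x = wexec q ws (x(Rgt := q @ x Rgt))"
  "wexec q (WQPop # ws) x = Some x' \<longleftrightarrow>
    (\<exists>ys. x Rgt = q @ ys \<and> wexec q ws (x(Rgt := ys)) = Some x')"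
  by (cases "x t") auto

lemmas [simp del] = wexec.simps(2)

lemma code_word_eq_prefix:
  "code_word r @ 0 # tail = code_word l @ ys \<longleftrightarrow> (\<exists>w. r = l @ w \<and> ys = code_word w @ 0 # tail)"
proof (induction l arbitrary: r)
  case (Cons a l)
  then show ?case by (cases r) auto
qed auto

lemma code_word_eq_Cons:
  "code_word r @ 0 # tail = code a # ys \<longleftrightarrow> (\<exists>w. r = a # w \<and> ys = code_word w @ 0 # tail)"
  using code_word_eq_prefix[of r tail "[a]" ys] by simp

lemma code_word_eq_zero:
  "code_word r @ 0 # tail = 0 # ys \<longleftrightarrow> r = [] \<and> ys = tail"
  by (cases r) auto

context
  fixes n :: "nat \<times> nat \<Rightarrow> nat" and e :: "letter \<Rightarrow> nat" and W :: "letter list"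
    and A G :: "letter set" and R :: "(letter list \<times> letter list) set"
  assumes n: "n \<in> enumerated_semigroups"
    and R: "\<And>l r. (l, r) \<in> R \<Longrightarrow> l \<noteq> [] \<and> r \<noteq> [] \<and> ev n e l = ev n e r"
    and W: "W \<noteq> []"
begin

text \<open>The invariant of the search: the value v of the current word is that of the quoted word in mode 1, and in
mode 2 that of the starting letter i, provided that the quoted word equals \<open>yes\<close>. It is stated
semantically, in a given semigroup that satisfies R.\<close>

definition goal_ok :: "nat \<Rightarrow> nat list \<Rightarrow> nat \<Rightarrow> bool" where
  "goal_ok m tail v \<longleftrightarrow> m = 1 \<and> tail = [] \<and> v = ev n e W \<or>
     m = 2 \<and> (\<exists>i j. i \<in> G \<and> j \<in> G \<and> i \<noteq> j \<and> tail = [code j] \<and> (ev n e W = e yes \<longrightarrow> v = e i))"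

definition sound_tape :: "(dreg \<Rightarrow> nat list) \<Rightarrow> bool" where
  "sound_tape x \<longleftrightarrow> x = wblank \<or>
     (\<exists>m l r tail. x = tape m l r tail \<and> goal_ok m tail (ev n e (rev l @ r)))"

lemma sound_tapeI:
  "x Mode = [m] \<Longrightarrow> x Lft = code_word l @ [0] \<Longrightarrow> x Rgt = code_word r @ 0 # tail \<Longrightarrow>
    goal_ok m tail (ev n e (rev l @ r)) \<Longrightarrow> sound_tape x"
  unfolding sound_tape_def eq_tape_iff by blast

text \<open>Moving the cursor does not change the word on the tape, and applying a relation does not change its
value. Neither does exchanging the quoted word and \<open>yes\<close> if their values are equal, which is all that is
claimed in mode 2.\<close>

lemma sound_step:
  assumes "sound_tape x" "wstep (code_word W) (prover_items A R G) x x'"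
  shows "sound_tape x'"
proof -
  from assms(2) obtain ws where ws: "(ws, None) \<in> prover_items A R G"
    and ex: "wexec (code_word W) ws x = Some x'" unfolding wstep_def by blast
  from assms(1) consider (blank) "x = wblank"
    | (tape) m l r tail where "x = tape m l r tail" "goal_ok m tail (ev n e (rev l @ r))"
    unfolding sound_tape_def by blast
  then show ?thesis
  proof cases
    case tape
    note x = tape(1) and ok = tape(2)
    from ws consider
      (rule) a b where "(a, b) \<in> R \<union> R\<inverse>"
        "ws = map (WPop Rgt) (code_word a) @ map (WPsh Rgt) (rev (code_word b))"
    | (right) a where "ws = [WPop Rgt (code a), WPsh Lft (code a)]"
    | (left) a where "ws = [WPop Lft (code a), WPsh Rgt (code a)]"
    | (fold) "ws = [WPop Mode 2, WQPop, WPsh Rgt (code yes), WPsh Mode 2]"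
    | (unfold) "ws = [WPop Mode 2, WPop Rgt (code yes), WQPush, WPsh Mode 2]"
    | (start) ws' where "ws = WPop Mode 0 # ws'"
      unfolding prover_items_def by fast
    then show ?thesis
    proof cases
      case (rule a b)
      with ex obtain ys where "x Rgt = code_word a @ ys" and x': "x' = x(Rgt := code_word b @ ys)"
        by (auto simp: wexec_rule)
      then obtain w where r: "r = a @ w" "ys = code_word w @ 0 # tail"
        unfolding x tape_simps code_word_eq_prefix by blast
      have "a \<noteq> []" "b \<noteq> []" "ev n e a = ev n e b"
        using rule(1) R[of a b] R[of b a] by auto
      then have "ev n e (rev l @ b @ w) = ev n e (rev l @ r)"
        unfolding r using ev_context[OF n] by metis
      then show ?thesis
        using ok x' r x by (intro sound_tapeI[of x' m l "b @ w" tail]) auto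
    next
      case (right a)
      with ex x obtain w where "r = a # w" "x' = x(Rgt := code_word w @ 0 # tail, Lft := code a # x Lft)"
        by (auto simp: code_word_eq_Cons)
      then show ?thesis
        using ok x by (intro sound_tapeI[of x' m "a # l" w tail]) auto
    next
      case (left a)
      with ex x obtain w where "l = a # w" "x' = x(Lft := code_word w @ [0], Rgt := code a # x Rgt)"
        by (auto simp: code_word_eq_Cons)
      then show ?thesis
        using ok x by (intro sound_tapeI[of x' m w "a # r" tail]) auto
    next
      case fold
      with ex x obtain w where w: "r = W @ w" "m = 2"
        "x' = x(Mode := [2], Rgt := code yes # code_word w @ 0 # tail)"
        by (auto simp: code_word_eq_prefix fun_upd_twist)
      have "ev n e W = e yes \<Longrightarrow> ev n e (rev l @ [yes] @ w) = ev n e (rev l @ r)"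
        unfolding w using ev_context[OF n, of "[yes]" W e "rev l" w] W by simp
      then show ?thesis
        using ok w x by (intro sound_tapeI[of x' m l "yes # w" tail]) (auto simp: goal_ok_def)
    next
      case unfold
      with ex x obtain w where w: "r = yes # w" "m = 2"
        "x' = x(Mode := [2], Rgt := code_word W @ code_word w @ 0 # tail)"
        by (auto simp: code_word_eq_Cons fun_upd_twist)
      have "ev n e W = e yes \<Longrightarrow> ev n e (rev l @ W @ w) = ev n e (rev l @ r)"
        unfolding w using ev_context[OF n, of "[yes]" W e "rev l" w] W by simp
      then show ?thesis
        using ok w x by (intro sound_tapeI[of x' m l "W @ w" tail]) (auto simp: goal_ok_def)
    next
      case (start ws')
      with ex x ok show ?thesis by (auto simp: goal_ok_def)
    qed
  next
    case blank
    from ws consider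
      (rule) a b where "(a, b) \<in> R \<union> R\<inverse>"
        "ws = map (WPop Rgt) (code_word a) @ map (WPsh Rgt) (rev (code_word b))"
    | (move) a ws' where "ws = WPop Rgt (code a) # ws' \<or> ws = WPop Lft (code a) # ws'"
    | (hyp) ws' where "ws = WPop Mode 2 # ws'"
    | (start1) "ws = [WPop Mode 0, WPsh Lft 0, WPsh Rgt 0, WQPush, WPsh Mode 1]"
    | (start2) i j where "i \<in> G" "j \<in> G" "i \<noteq> j"
        "ws = [WPop Mode 0, WPsh Lft 0, WPsh Rgt (code j), WPsh Rgt 0, WPsh Rgt (code i), WPsh Mode 2]"
      unfolding prover_items_def by fast
    then show ?thesis
    proof cases
      case (rule a b)
      have "a \<noteq> []"
        using rule(1) R[of a b] R[of b a] by auto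
      then have "code_word a \<noteq> []" by (simp add: code_word_def)
      with rule ex blank show ?thesis by (simp add: wexec_rule)
    next
      case start1
      with ex blank show ?thesis
        by (intro sound_tapeI[of x' 1 "[]" W "[]"]) (auto simp: goal_ok_def)
    next
      case (start2 i j)
      with ex blank show ?thesis
        by (intro sound_tapeI[of x' 2 "[]" "[i]" "[code j]"]) (auto simp: goal_ok_def)
    qed (use ex blank in auto)
  qed
qed

lemma prover_sound:
  assumes "waccepts (code_word W) (prover_items A R G) b"
  shows "if b then ev n e W = e yes \<longrightarrow> (\<exists>i\<in>G. \<exists>j\<in>G. i \<noteq> j \<and> e i = e j) else ev n e W = e yes"
proof -
  from assms obtain x x' ws where
    x: "(wstep (code_word W) (prover_items A R G))\<^sup>*\<^sup>* wblank x"
    and ws: "(ws, Some b) \<in> prover_items A R G" and ex: "wexec (code_word W) ws x = Some x'"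
    unfolding waccepts_def by blast
  from x have "sound_tape x"
    by (induction rule: rtranclp_induct) (auto simp: sound_step, simp add: sound_tape_def)
  then consider (blank) "x = wblank"
    | (tape) m l r tail where "x = tape m l r tail" "goal_ok m tail (ev n e (rev l @ r))"
    unfolding sound_tape_def by blast
  then show ?thesis
  proof cases
    case blank
    from ws obtain k ws' where "ws = WPop Mode k # ws'" "k \<noteq> 0"
      unfolding prover_items_def by auto
    with ex blank show ?thesis by (auto simp: wblank_def)
  next
    case tape
    from ws consider
      "b = False" "ws = [WPop Mode 1, WPop Lft 0, WPop Rgt (code yes), WPop Rgt 0]"
    | j where "b = True" "j \<in> G" "ws = [WPop Mode 2, WPop Lft 0, WPop Rgt (code j), WPop Rgt 0, WPop Rgt (code j)]"
      unfolding prover_items_def by fast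
    then show ?thesis
    proof cases
      case 1
      with ex tape show ?thesis
        by (auto simp: code_word_eq_Cons code_word_eq_zero goal_ok_def)
    next
      case (2 j)
      with ex tape show ?thesis
        by (auto simp: code_word_eq_Cons code_word_eq_zero goal_ok_def) metis
    qed
  qed
qed

end


lemma wstepI: "(ws, None) \<in> I \<Longrightarrow> wexec q ws x = Some x' \<Longrightarrow> wstep q I x x'"
  by (auto simp: wstep_def)

lemma wstep_right: "a \<in> A \<Longrightarrow>
  wstep q (prover_items A R G) (tape m l (a # r) tail) (tape m (a # l) r tail)"
  by (rule wstepI[of "[WPop Rgt (code a), WPsh Lft (code a)]"])
    (auto simp: prover_items_def eq_tape_iff)

lemma wstep_left: "a \<in> A \<Longrightarrow>
  wstep q (prover_items A R G) (tape m (a # l) r tail) (tape m l (a # r) tail)"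
  by (rule wstepI[of "[WPop Lft (code a), WPsh Rgt (code a)]"])
    (auto simp: prover_items_def eq_tape_iff)

lemma wsteps_right: "set u \<subseteq> A \<Longrightarrow>
  (wstep q (prover_items A R G))\<^sup>*\<^sup>* (tape m l (u @ r) tail) (tape m (rev u @ l) r tail)"
proof (induction u arbitrary: l)
  case (Cons a u)
  have "wstep q (prover_items A R G) (tape m l (a # u @ r) tail) (tape m (a # l) (u @ r) tail)"
    using Cons.prems by (intro wstep_right) simp
  from converse_rtranclp_into_rtranclp[OF this Cons.IH[of "a # l"]] Cons.prems
  show ?case by simp
qed simp

lemma wsteps_left: "set u \<subseteq> A \<Longrightarrow>
  (wstep q (prover_items A R G))\<^sup>*\<^sup>* (tape m (rev u @ l) r tail) (tape m l (u @ r) tail)"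
proof (induction u arbitrary: r rule: rev_induct)
  case (snoc a u)
  have "wstep q (prover_items A R G) (tape m (a # rev u @ l) r tail) (tape m (rev u @ l) (a # r) tail)"
    using snoc.prems by (intro wstep_left) simp
  from converse_rtranclp_into_rtranclp[OF this snoc.IH[of "a # r"]] snoc.prems
  show ?case by simp
qed simp

text \<open>One step of a derivation is imitated by moving the cursor to the place of the replacement, by replacing, and
by moving back to the left end. Since A contains the letters of the first word and of the relations, the
cursor can move over all words of the derivation.\<close>

lemma wsteps_thue:
  assumes letters: "\<And>a b. (a, b) \<in> R' \<Longrightarrow> set a \<union> set b \<subseteq> A"
    and local: "\<And>a b l w. (a, b) \<in> R' \<union> R'\<inverse> \<Longrightarrow>
      wstep q (prover_items A R G) (tape m l (a @ w) tail) (tape m l (b @ w) tail)"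
    and "thue R' x y" "set x \<subseteq> A"
  shows "(wstep q (prover_items A R G))\<^sup>*\<^sup>* (tape m [] x tail) (tape m [] y tail)"
proof -
  have "set y \<subseteq> A \<and> (wstep q (prover_items A R G))\<^sup>*\<^sup>* (tape m [] x tail) (tape m [] y tail)"
    using assms(3) unfolding thue_def
  proof (induction rule: rtranclp_induct)
    case base
    then show ?case using assms(4) by simp
  next
    case (step y z)
    then obtain u a b w where ab: "(a, b) \<in> R' \<union> R'\<inverse>" "y = u @ a @ w" "z = u @ b @ w"
      unfolding rewrite_def by blast
    have u: "set u \<subseteq> A" and "set w \<subseteq> A"
      using step.IH ab(2) by auto
    moreover have "set b \<subseteq> A"
      using ab(1) letters[of a b] letters[of b a] by auto
    ultimately have z: "set z \<subseteq> A" by (simp add: ab(3))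
    have 1: "(wstep q (prover_items A R G))\<^sup>*\<^sup>* (tape m [] y tail) (tape m (rev u) (a @ w) tail)"
      using wsteps_right[OF u, of q R G m "[]" "a @ w" tail] by (simp add: ab(2))
    have 2: "(wstep q (prover_items A R G))\<^sup>*\<^sup>* (tape m (rev u) (b @ w) tail) (tape m [] z tail)"
      using wsteps_left[OF u, of q R G m "[]" "b @ w" tail] by (simp add: ab(3))
    have 3: "wstep q (prover_items A R G) (tape m (rev u) (a @ w) tail) (tape m (rev u) (b @ w) tail)"
      using local[OF ab(1)] .
    have "(wstep q (prover_items A R G))\<^sup>*\<^sup>* (tape m [] y tail) (tape m [] z tail)"
      by (rule rtranclp_trans[OF 1 converse_rtranclp_into_rtranclp[OF 3 2]])
    with step.IH z show ?case using rtranclp_trans by meson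
  qed
  then show ?thesis ..
qed

lemma wstep_rule: "(a, b) \<in> R \<union> R\<inverse> \<Longrightarrow>
  wstep q (prover_items A R G) (tape m l (a @ w) tail) (tape m l (b @ w) tail)"
  by (rule wstepI[of "map (WPop Rgt) (code_word a) @ map (WPsh Rgt) (rev (code_word b))"])
    (auto simp: prover_items_def wexec_rule eq_commute[of "tape m l (b @ w) tail"] eq_tape_iff)

lemma wstep_fold:
  "wstep (code_word W) (prover_items A R G) (tape 2 l (W @ w) tail) (tape 2 l (yes # w) tail)"
  by (rule wstepI[of "[WPop Mode 2, WQPop, WPsh Rgt (code yes), WPsh Mode 2]"])
    (auto simp: prover_items_def eq_tape_iff)

lemma wstep_unfold:
  "wstep (code_word W) (prover_items A R G) (tape 2 l (yes # w) tail) (tape 2 l (W @ w) tail)"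
  by (rule wstepI[of "[WPop Mode 2, WPop Rgt (code yes), WQPush, WPsh Mode 2]"])
    (auto simp: prover_items_def eq_tape_iff)

lemma prover_proves:
  assumes letters: "\<And>a b. (a, b) \<in> R \<Longrightarrow> set a \<union> set b \<subseteq> A"
    and "set W \<subseteq> A" "thue R W [yes]"
  shows "waccepts (code_word W) (prover_items A R G) False"
proof -
  let ?q = "code_word W" and ?I = "prover_items A R G"
  have "wstep ?q ?I wblank (tape 1 [] W [])"
    by (rule wstepI[of "[WPop Mode 0, WPsh Lft 0, WPsh Rgt 0, WQPush, WPsh Mode 1]"])
      (auto simp: prover_items_def eq_tape_iff)
  moreover have "(wstep ?q ?I)\<^sup>*\<^sup>* (tape 1 [] W []) (tape 1 [] [yes] [])"
    using letters wstep_rule assms(3,2) by (rule wsteps_thue)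
  ultimately have "(wstep ?q ?I)\<^sup>*\<^sup>* wblank (tape 1 [] [yes] [])"
    by (rule converse_rtranclp_into_rtranclp)
  moreover have "\<exists>x'. wexec ?q [WPop Mode 1, WPop Lft 0, WPop Rgt (code yes), WPop Rgt 0]
      (tape 1 [] [yes] []) = Some x'"
    by simp
  moreover have "([WPop Mode 1, WPop Lft 0, WPop Rgt (code yes), WPop Rgt 0], Some False) \<in> ?I"
    by (simp add: prover_items_def)
  ultimately show ?thesis unfolding waccepts_def by blast
qed

lemma prover_refutes:
  assumes letters: "\<And>a b. (a, b) \<in> R \<Longrightarrow> set a \<union> set b \<subseteq> A"
    and "set W \<subseteq> A" "yes \<in> A" "G \<subseteq> A"
    and ij: "i \<in> G" "j \<in> G" "i \<noteq> j" and th: "thue (insert (W, [yes]) R) [i] [j]"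
  shows "waccepts (code_word W) (prover_items A R G) True"
proof -
  let ?q = "code_word W" and ?I = "prover_items A R G"
  have "wstep ?q ?I wblank (tape 2 [] [i] [code j])"
    by (rule wstepI[of "[WPop Mode 0, WPsh Lft 0, WPsh Rgt (code j), WPsh Rgt 0, WPsh Rgt (code i), WPsh Mode 2]"])
      (use ij in \<open>auto simp: prover_items_def eq_tape_iff\<close>)
  moreover have "(wstep ?q ?I)\<^sup>*\<^sup>* (tape 2 [] [i] [code j]) (tape 2 [] [j] [code j])"
  proof (rule wsteps_thue[OF _ _ th])
    show "(a, b) \<in> insert (W, [yes]) R \<Longrightarrow> set a \<union> set b \<subseteq> A" for a b
      using letters assms(2,3) by auto
    show "wstep ?q ?I (tape 2 l (a @ w) [code j]) (tape 2 l (b @ w) [code j])"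
      if "(a, b) \<in> insert (W, [yes]) R \<union> (insert (W, [yes]) R)\<inverse>" for a b l w
      using that wstep_rule[of a b R] wstep_fold wstep_unfold by auto
    show "set [i] \<subseteq> A" using ij assms(4) by auto
  qed
  ultimately have "(wstep ?q ?I)\<^sup>*\<^sup>* wblank (tape 2 [] [j] [code j])"
    by (rule converse_rtranclp_into_rtranclp)
  moreover have "\<exists>x'. wexec ?q [WPop Mode 2, WPop Lft 0, WPop Rgt (code j), WPop Rgt 0, WPop Rgt (code j)]
      (tape 2 [] [j] [code j]) = Some x'"
    by simp
  moreover have "([WPop Mode 2, WPop Lft 0, WPop Rgt (code j), WPop Rgt 0, WPop Rgt (code j)], Some True) \<in> ?I"
    using ij by (auto simp: prover_items_def)
  ultimately show ?thesis unfolding waccepts_def by blast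
qed

lemma finite_prover_items:
  assumes "finite A" "finite R" "finite G"
  shows "finite (prover_items A R G)"
proof -
  have "{(map (WPop Rgt) (code_word l) @ map (WPsh Rgt) (rev (code_word r)), None :: bool option) |l r.
      (l, r) \<in> R \<union> R\<inverse>}
    = (\<lambda>(l, r). (map (WPop Rgt) (code_word l) @ map (WPsh Rgt) (rev (code_word r)), None)) ` (R \<union> R\<inverse>)"
    by force
  moreover have "finite (R \<union> R\<inverse>)" using assms by simp
  moreover have "{([WPop Mode 0, WPsh Lft 0, WPsh Rgt (code j), WPsh Rgt 0, WPsh Rgt (code i), WPsh Mode 2], None :: bool option) |i j.
        i \<in> G \<and> j \<in> G \<and> i \<noteq> j} \<subseteq>
     (\<lambda>(i, j). ([WPop Mode 0, WPsh Lft 0, WPsh Rgt (code j), WPsh Rgt 0, WPsh Rgt (code i), WPsh Mode 2], None)) ` (G \<times> G)"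
    by force
  then have "finite {([WPop Mode 0, WPsh Lft 0, WPsh Rgt (code j), WPsh Rgt 0, WPsh Rgt (code i), WPsh Mode 2], None :: bool option) |i j.
        i \<in> G \<and> j \<in> G \<and> i \<noteq> j}"
    by (rule finite_subset) (use assms in simp)
  ultimately show ?thesis
    unfolding prover_items_def using assms by (simp add: setcompr_eq_image)
qed

definition satisfies :: "(nat \<times> nat \<Rightarrow> nat) \<Rightarrow> (gen \<Rightarrow> nat) \<Rightarrow> bool" where
  "satisfies n v \<longleftrightarrow> (\<forall>(l, r) \<in> machine_relations. ev n v l = ev n v r)"

text \<open>The diagonal argument. The program k looks for the two derivations in question for its own query. If
one of them existed, the machine would halt on k with some answer. By soundness of the search this
contradicts either the difference of the two answers or the injectivity of e on G, since the answer
is given the opposite meaning of what has been found.\<close>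

lemma undecided_query:
  assumes n: "n \<in> enumerated_semigroups"
    and v: "satisfies n (e \<circ> Gen)" "e (Gen (Fn (Halt True))) \<noteq> e (Gen (Fn (Halt False)))"
    and R: "finite R" "\<And>l r. (l, r) \<in> R \<Longrightarrow> l \<noteq> [] \<and> r \<noteq> [] \<and> ev n e l = ev n e r"
    and G: "finite G" "inj_on e G"
  shows "\<exists>k. \<not> thue R (map Gen (query k)) [yes] \<and>
    (\<forall>i\<in>G. \<forall>j\<in>G. i \<noteq> j \<longrightarrow> \<not> thue (insert (map Gen (query k), [yes]) R) [i] [j])"
proof -
  define A where "A = range Gen \<union> G \<union> (\<Union>(l, r)\<in>R. set l \<union> set r)"
  have A: "finite A" "range Gen \<subseteq> A" "G \<subseteq> A"
    using R(1) G(1) by (auto simp: A_def)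
  have letters: "set a \<union> set b \<subseteq> A" if "(a, b) \<in> R" for a b
    using that by (auto simp: A_def)
  let ?I = "prover_items A R G"
  obtain Is where "set Is = ?I"
    using finite_list finite_prover_items[OF A(1) R(1) G(1)] by blast
  then have its: "set (map (\<lambda>(ws, a). (compile ws, a)) Is) = (\<lambda>(ws, a). (compile ws, a)) ` ?I"
    by simp
  define its where "its = map (\<lambda>(ws, a). (compile ws, a)) Is"
  define k where "k = program its"
  let ?W = "map Gen (query k)"
  have W: "?W \<noteq> []" "set ?W \<subseteq> A"
    using A(2) by (auto simp: query_def)
  have q: "map (code \<circ> Gen) (query k) = code_word ?W"
    by (simp add: code_word_def)
  have acc: "accepts (enc (code_word ?W)) its b \<longleftrightarrow> waccepts (code_word ?W) ?I b" for b
    using its unfolding its_def by (rule accepts_iff_waccepts)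
  have "\<not> accepts (enc (code_word ?W)) its b0" for b0
  proof
    assume "accepts (enc (code_word ?W)) its b0"
    moreover have "plain_items its"
      by (auto simp: plain_items_def its_def plain_compile)
    ultimately obtain b where "accepts (enc (code_word ?W)) its b"
      and th: "thue machine_relations (query k) [Fn (Halt b)]"
      using query_decided[of its "enc (code_word ?W)" b0] q unfolding k_def by auto
    then have "waccepts (code_word ?W) ?I b" using acc by blast
    from prover_sound[OF n R(2) W(1) this]
    have sound: "if b then ev n e ?W = e yes \<longrightarrow> (\<exists>i\<in>G. \<exists>j\<in>G. i \<noteq> j \<and> e i = e j)
      else ev n e ?W = e yes" .
    have "ev n (e \<circ> Gen) (query k) = ev n (e \<circ> Gen) [Fn (Halt b)]"
      by (rule thue_sound[OF n _ th]) (use v(1) machine_relations_nonempty in \<open>auto simp: satisfies_def\<close>)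
    then have "ev n e ?W = e (Gen (Fn (Halt b)))"
      using W(1) by (subst ev_map) auto
    with sound v(2) G(2) show False
      by (cases b) (auto simp: inj_on_def)
  qed
  then have "\<not> waccepts (code_word ?W) ?I b" for b
    using acc by blast
  then show ?thesis
    using prover_proves[OF letters W(2)] prover_refutes[OF letters W(2) _ A(3)] A(2) by blast
qed


section \<open>Finite pieces of multiplication tables do not decide all queries\<close>

lemma thue_map:
  assumes "\<And>l r. (l, r) \<in> R \<Longrightarrow> (map h l, map h r) \<in> R'" and "thue R x y"
  shows "thue R' (map h x) (map h y)"
  using assms(2) unfolding thue_def
proof (induction rule: rtranclp_induct)
  case (step y z)
  then obtain u l r w where lr: "(l, r) \<in> R \<union> R\<inverse>" "y = u @ l @ w" "z = u @ r @ w"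
    unfolding rewrite_def by blast
  have "(map h l, map h r) \<in> R' \<union> R'\<inverse>"
    using lr(1) assms(1) by auto
  then have "rewrite R' (map h y) (map h z)"
    unfolding rewrite_def
    by (intro exI[of _ "map h u"] exI[of _ "map h l"] exI[of _ "map h r"] exI[of _ "map h w"])
      (simp add: lr)
  with step.IH show ?case by (rule rtranclp.rtrancl_into_rtrancl)
qed simp

lemma infinite_letters: "finite B \<Longrightarrow> infinite (- B :: letter set)"
proof -
  have "infinite (range Elem)"
    by (rule range_inj_infinite) (auto simp: inj_def)
  then have "infinite (UNIV :: letter set)"
    by (rule infinite_super[OF subset_UNIV])
  then show "finite B \<Longrightarrow> infinite (- B :: letter set)"
    by (simp add: Compl_eq_Diff_UNIV)
qed

text \<open>The machine relations are transferred to the larger alphabet, because infinitely many further letters are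
needed to make the presented semigroup infinite.\<close>

lemma machine_semigroup_exists:
  obtains n v where "n \<in> enumerated_semigroups" "satisfies n v"
    "v (Fn (Halt True)) \<noteq> v (Fn (Halt False))"
proof -
  define R where "R = (\<lambda>(l, r). (map Gen l, map Gen r)) ` machine_relations"
  define gen_of where "gen_of a = (case a of Gen g \<Rightarrow> g | Elem i \<Rightarrow> Fn Init)" for a
  have map_gen_of: "map gen_of (map Gen w) = w" for w
    by (induction w) (auto simp: gen_of_def)
  let ?G = "{Gen (Fn (Halt True)), Gen (Fn (Halt False))}"
  have TF: "\<not> thue R [Gen (Fn (Halt True))] [Gen (Fn (Halt False))]"
  proof
    assume "thue R [Gen (Fn (Halt True))] [Gen (Fn (Halt False))]"
    then have "thue machine_relations (map gen_of (map Gen [Fn (Halt True)])) (map gen_of (map Gen [Fn (Halt False)]))"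
      by (intro thue_map[of R gen_of]) (auto simp: R_def map_gen_of simp del: map_map)
    then show False using machine_relations_consistent unfolding map_gen_of by blast
  qed
  obtain n e where n: "n \<in> enumerated_semigroups" and e: "\<And>i. i \<in> ?G \<Longrightarrow> e i = to_nat i"
    and ev: "\<And>x y. x \<noteq> [] \<Longrightarrow> y \<noteq> [] \<Longrightarrow> ev n e x = ev n e y \<longleftrightarrow> thue R x y"
  proof (rule presented_semigroup_realisation[of R "range Gen" ?G to_nat])
    show "l \<noteq> [] \<and> r \<noteq> [] \<and> set l \<union> set r \<subseteq> range Gen" if "(l, r) \<in> R" for l r
      using that machine_relations_nonempty unfolding R_def by fastforce
    show "infinite (- range Gen)"
      by (intro infinite_letters) simp
    show "\<not> thue R [i] [j]" if "i \<in> ?G" "j \<in> ?G" "i \<noteq> j" for i j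
      using that TF thue_sym by blast
  qed auto
  have "satisfies n (e \<circ> Gen)"
    unfolding satisfies_def
  proof safe
    fix l r assume lr: "(l, r) \<in> machine_relations"
    then have "(map Gen l, map Gen r) \<in> R"
      by (force simp: R_def)
    with machine_relations_nonempty[OF lr] show "ev n (e \<circ> Gen) l = ev n (e \<circ> Gen) r"
      using ev[of "map Gen l" "map Gen r"] by (simp add: thue_relation ev_map[symmetric])
  qed
  moreover have "(e \<circ> Gen) (Fn (Halt True)) \<noteq> (e \<circ> Gen) (Fn (Halt False))"
    using e by simp
  ultimately show ?thesis using that n by blast
qed

definition accepted :: "(nat \<times> nat \<Rightarrow> nat) \<Rightarrow> (gen \<Rightarrow> nat) \<Rightarrow> oper list set" where
  "accepted n v = {k. ev n v (query k) = v (Fn (Halt True))}"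

lemma query_nonempty: "query k \<noteq> []"
  by (simp add: query_def)

text \<open>The piece of the table of n on E, with the assignment v of the machine letters, is a finite presentation
whose elements are different numbers. For the query that it does not decide, both the presentation
itself and the presentation with the additional equation can be realised on the natural numbers with
all these elements in their places. In the first semigroup the query fails, in the second it holds.\<close>

lemma no_neighbourhood_decides:
  assumes n: "n \<in> enumerated_semigroups"
    and v: "satisfies n v" "v (Fn (Halt True)) \<noteq> v (Fn (Halt False))" and E: "finite E"
  shows "\<exists>n1 n2. n1 \<in> enumerated_semigroups \<and> n2 \<in> enumerated_semigroups \<and>
    (\<forall>p\<in>E. n1 p = n p) \<and> (\<forall>p\<in>E. n2 p = n p) \<and> accepted n1 v \<noteq> accepted n2 v"
proof -
  define e where "e a = (case a of Gen g \<Rightarrow> v g | Elem i \<Rightarrow> i)" for a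
  have e [simp]: "e (Gen g) = v g" "e (Elem i) = i" for g i
    by (auto simp: e_def)
  have e_Gen: "e \<circ> Gen = v"
    by (simp add: fun_eq_iff)
  define R where "R = (\<lambda>(i, j). ([Elem i, Elem j], [Elem (n (i, j))])) ` E
    \<union> range (\<lambda>g. ([Gen g], [Elem (v g)]))"
  define G where "G = Elem ` (fst ` E \<union> snd ` E \<union> n ` E \<union> range v)"
  have fin: "finite R" "finite G"
    using E by (auto simp: R_def G_def)
  have inj: "inj_on e G"
    by (auto simp: inj_on_def G_def)
  have R: "l \<noteq> [] \<and> r \<noteq> [] \<and> ev n e l = ev n e r" if "(l, r) \<in> R" for l r
    using that by (auto simp: R_def)
  have G_E: "Elem i \<in> G" "Elem j \<in> G" "Elem (n (i, j)) \<in> G" if "(i, j) \<in> E" for i j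
    using imageI[OF that, of fst] imageI[OF that, of snd] imageI[OF that, of n]
    by (simp_all add: G_def)
  have G_v: "Elem (v g) \<in> G" for g
    by (simp add: G_def)
  have R_letters: "l \<noteq> [] \<and> r \<noteq> [] \<and> set l \<union> set r \<subseteq> range Gen \<union> G" if "(l, r) \<in> R" for l r
    using that G_E G_v by (auto simp: R_def)
  obtain k where k1: "\<not> thue R (map Gen (query k)) [yes]"
    and k2: "\<And>i j. i \<in> G \<Longrightarrow> j \<in> G \<Longrightarrow> i \<noteq> j \<Longrightarrow>
      \<not> thue (insert (map Gen (query k), [yes]) R) [i] [j]"
    using undecided_query[OF n, of e R G] v fin inj R unfolding e_Gen e(1) by blast
  \<comment> \<open>both realisations at once: R' is R or R with the equation added\<close>
  have extend: "\<exists>n'. n' \<in> enumerated_semigroups \<and> (\<forall>p\<in>E. n' p = n p) \<and>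
      (k \<in> accepted n' v \<longleftrightarrow> thue R' (map Gen (query k)) [yes])"
    if R': "R \<subseteq> R'" "R' \<subseteq> insert (map Gen (query k), [yes]) R" for R'
  proof -
    obtain n' e' where n': "n' \<in> enumerated_semigroups" and e': "\<And>i. i \<in> G \<Longrightarrow> e' i = e i"
      and ev': "\<And>x y. x \<noteq> [] \<Longrightarrow> y \<noteq> [] \<Longrightarrow> ev n' e' x = ev n' e' y \<longleftrightarrow> thue R' x y"
    proof (rule presented_semigroup_realisation[of R' "range Gen \<union> G" G e])
      show "l \<noteq> [] \<and> r \<noteq> [] \<and> set l \<union> set r \<subseteq> range Gen \<union> G" if lr: "(l, r) \<in> R'" for l r
      proof -
        consider "(l, r) \<in> R" | "l = map Gen (query k)" "r = [yes]"
          using subsetD[OF R'(2) lr] by blast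
        then show ?thesis by cases (use R_letters[of l r] in \<open>auto simp: query_nonempty\<close>)
      qed
      show "infinite (- (range Gen \<union> G))"
        using fin(2) by (intro infinite_letters) simp
      show "\<not> thue R' [i] [j]" if "i \<in> G" "j \<in> G" "i \<noteq> j" for i j
        using k2[OF that] R'(2) thue_mono by blast
    qed (use fin inj in auto)
    have rel: "ev n' e' l = ev n' e' r" if "(l, r) \<in> R" for l r
      using ev'[of l r] R[OF that] that R'(1) thue_relation by blast
    have "n' p = n p" if p: "p \<in> E" for p
    proof -
      obtain i j where ij: "p = (i, j)" by fastforce
      have "Elem i \<in> G" "Elem j \<in> G" "Elem (n (i, j)) \<in> G"
        using p ij G_E by simp_all
      moreover have "([Elem i, Elem j], [Elem (n (i, j))]) \<in> R"
        using p ij by (force simp: R_def)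
      from rel[OF this] have "n' (e' (Elem i), e' (Elem j)) = e' (Elem (n (i, j)))" by simp
      ultimately show ?thesis using ij by (simp add: e')
    qed
    moreover have e'_Gen: "e' \<circ> Gen = v"
    proof
      fix g
      have "([Gen g], [Elem (v g)]) \<in> R" "Elem (v g) \<in> G"
        by (auto simp: R_def G_v)
      with rel[OF this(1)] e' show "(e' \<circ> Gen) g = v g" by simp
    qed
    have "k \<in> accepted n' v \<longleftrightarrow> thue R' (map Gen (query k)) [yes]"
    proof -
      have "e' yes = v (Fn (Halt True))"
        using fun_cong[OF e'_Gen, of "Fn (Halt True)"] by simp
      then have "k \<in> accepted n' v \<longleftrightarrow> ev n' e' (map Gen (query k)) = ev n' e' [yes]"
        unfolding accepted_def using e'_Gen
        by (simp add: ev_map query_nonempty)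
      then show ?thesis
        using ev'[of "map Gen (query k)" "[yes]"] query_nonempty by simp
    qed
    ultimately show ?thesis using n' by blast
  qed
  obtain n1 where "n1 \<in> enumerated_semigroups" "\<forall>p\<in>E. n1 p = n p" "k \<notin> accepted n1 v"
    using extend[of R] k1 by blast
  moreover obtain n2 where "n2 \<in> enumerated_semigroups" "\<forall>p\<in>E. n2 p = n p" "k \<in> accepted n2 v"
    using extend[of "insert (map Gen (query k), [yes]) R"] thue_relation by blast
  ultimately show ?thesis by blast
qed

section \<open>The category argument\<close>

text \<open>The value of a word depends on finitely many entries of the multiplication table.\<close>

lemma open_ev_fibre: "open {n. ev n v w = c}"
proof (induction w arbitrary: c rule: induct_list012)
  case (3 a b w)
  have coord: "open {n :: nat \<times> nat \<Rightarrow> nat. n p = c}" for p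
    using open_vimage[OF open_discrete[of "{c}"] continuous_on_product_coordinates[of p]]
    by (simp add: vimage_def)
  have "{n. ev n v (a # b # w) = c}
      = (\<Union>d. {n. ev n v (b # w) = d} \<inter> {n. n (v a, d) = c})"
    by auto
  then show ?case
    by (simp only:) (intro open_UN ballI open_Int 3(2) coord)
qed auto

lemma continuous_ev: "continuous_on UNIV (\<lambda>n. ev n v w)"
proof -
  have "open ((\<lambda>n. ev n v w) -` B)" for B
  proof -
    have "(\<lambda>n. ev n v w) -` B = (\<Union>c\<in>B. {n. ev n v w = c})" by auto
    then show ?thesis by (simp only:) (intro open_UN ballI open_ev_fibre)
  qed
  then show ?thesis by (simp add: continuous_on_open_vimage)
qed

lemma completely_metrizable_enumerated_semigroup_space:
  "completely_metrizable_space enumerated_semigroup_space"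
proof -
  have "(euclidean :: nat topology) = discrete_topology UNIV"
    by (simp add: topology_eq open_discrete)
  then have "completely_metrizable_space (euclidean :: nat topology)"
    by (simp add: completely_metrizable_space_discrete_topology)
  then have "completely_metrizable_space (euclidean :: (nat \<times> nat \<Rightarrow> nat) topology)"
    unfolding euclidean_product_topology[symmetric]
    by (simp add: completely_metrizable_space_product_topology)
  then show ?thesis
    unfolding enumerated_semigroup_space_def
    using closed_enumerated_semigroups unfolding closed_closedin
    by (rule completely_metrizable_space_closedin)
qed

lemma topspace_enumerated_semigroup_space [simp]:
  "topspace enumerated_semigroup_space = enumerated_semigroups"
  by (simp add: enumerated_semigroup_space_def)

text \<open>Since the natural numbers are discrete, basic neighbourhoods fix finitely many entries of the table.\<close>

lemma finite_neighbourhood: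
  assumes "openin enumerated_semigroup_space U" "n \<in> U"
  obtains E where "finite E"
    "\<And>n'. n' \<in> enumerated_semigroups \<Longrightarrow> (\<forall>p\<in>E. n' p = n p) \<Longrightarrow> n' \<in> U"
proof -
  obtain V where V: "open V" "U = enumerated_semigroups \<inter> V"
    using assms(1) by (auto simp: enumerated_semigroup_space_def openin_open)
  then have "openin (product_topology (\<lambda>_. euclidean) UNIV) V" "n \<in> V"
    using assms(2) by (auto simp: open_fun_def)
  from product_topology_open_contains_basis[OF this] obtain X where
    X: "n \<in> Pi\<^sub>E UNIV X" "finite {p. X p \<noteq> UNIV}" "Pi\<^sub>E UNIV X \<subseteq> V"
    by auto
  show ?thesis
  proof (rule that[OF X(2)])
    fix n' assume n': "n' \<in> enumerated_semigroups" "\<forall>p\<in>{p. X p \<noteq> UNIV}. n' p = n p"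
    have "n' p \<in> X p" for p
    proof (cases "X p = UNIV")
      case False
      then have "n' p = n p" using n'(2) by blast
      then show ?thesis using X(1) by (simp add: PiE_iff del: split_paired_All)
    qed simp
    then show "n' \<in> U"
      using X(3) V(2) n'(1) by (auto simp: PiE_iff)
  qed
qed

lemma finite_machine_relations: "finite machine_relations"
proof -
  have "machine_relations \<subseteq>
      range (\<lambda>(s, t, x, y). ([Push s x, Push t y], [Push t y, Push s x]))
    \<union> range (\<lambda>(q, x). ([Push (source q) x, Fn q], push_word (fst (delta q x)) @ [Fn (snd (delta q x))]))
    \<union> range (\<lambda>(s, x, b). ([Push s x, Fn (Halt b)], [Fn (Halt b)]))"
    unfolding machine_relations_def by (force simp: image_iff)
  then show ?thesis
    by (rule finite_subset) simp
qed

lemma openin_satisfies: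
  "openin enumerated_semigroup_space {n \<in> enumerated_semigroups. satisfies n v}"
proof -
  have "open {n. ev n v l = ev n v r}" for l r :: "gen list"
  proof -
    have "{n. ev n v l = ev n v r} = (\<Union>c. {n. ev n v l = c} \<inter> {n. ev n v r = c})" by auto
    then show ?thesis by (simp only:) (intro open_UN ballI open_Int open_ev_fibre)
  qed
  then have "open (\<Inter>(l, r)\<in>machine_relations. {n. ev n v l = ev n v r})"
    using finite_machine_relations by (intro open_INT) auto
  moreover have "{n \<in> enumerated_semigroups. satisfies n v}
    = enumerated_semigroups \<inter> (\<Inter>(l, r)\<in>machine_relations. {n. ev n v l = ev n v r})"
    by (auto simp: satisfies_def)
  ultimately show ?thesis
    unfolding enumerated_semigroup_space_def openin_open by blast
qed

definition fibre :: "(gen \<Rightarrow> nat) \<Rightarrow> oper list set \<Rightarrow> (nat \<times> nat \<Rightarrow> nat) set" where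
  "fibre v K = {n \<in> enumerated_semigroups. satisfies n v \<and> accepted n v = K}"

lemma closedin_fibre: "closedin enumerated_semigroup_space (fibre v K)"
proof -
  have cl: "closed {n. ev n v l = ev n v r}" for l r :: "gen list"
    by (intro closed_Collect_eq continuous_ev)
  have "closed {n. ev n v (query k) = v (Fn (Halt True)) \<longleftrightarrow> k \<in> K}" for k
  proof (cases "k \<in> K")
    case True
    then show ?thesis
      by (simp add: closed_Collect_eq continuous_ev)
  next
    case False
    then show ?thesis
      using open_ev_fibre[of v "query k"] by (simp add: closed_def Collect_neg_eq)
  qed
  with cl have "closed ((\<Inter>(l, r)\<in>machine_relations. {n. ev n v l = ev n v r}) \<inter>
      (\<Inter>k. {n. ev n v (query k) = v (Fn (Halt True)) \<longleftrightarrow> k \<in> K}))"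
    by (intro closed_Int closed_INT) auto
  moreover have "fibre v K = enumerated_semigroups \<inter>
     ((\<Inter>(l, r)\<in>machine_relations. {n. ev n v l = ev n v r}) \<inter>
      (\<Inter>k. {n. ev n v (query k) = v (Fn (Halt True)) \<longleftrightarrow> k \<in> K}))"
    by (auto simp: fibre_def satisfies_def accepted_def)
  ultimately show ?thesis
    unfolding enumerated_semigroup_space_def closedin_closed by blast
qed

lemma interior_fibre:
  assumes "v (Fn (Halt True)) \<noteq> v (Fn (Halt False))"
  shows "enumerated_semigroup_space interior_of (fibre v K) = {}"
proof (rule ccontr)
  assume "enumerated_semigroup_space interior_of (fibre v K) \<noteq> {}"
  then obtain n U where U: "openin enumerated_semigroup_space U" "U \<subseteq> fibre v K" "n \<in> U"
    unfolding interior_of_def by blast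
  then have n: "n \<in> enumerated_semigroups" "satisfies n v"
    by (auto simp: fibre_def)
  obtain E where E: "finite E"
    "\<And>n'. n' \<in> enumerated_semigroups \<Longrightarrow> (\<forall>p\<in>E. n' p = n p) \<Longrightarrow> n' \<in> U"
    using finite_neighbourhood[OF U(1,3)] by blast
  obtain n1 n2 where "n1 \<in> U" "n2 \<in> U" "accepted n1 v \<noteq> accepted n2 v"
    using no_neighbourhood_decides[OF n assms E(1)] E(2) by blast
  then show False
    using U(2) by (auto simp: fibre_def)
qed

lemma accepted_isomorphic:
  assumes h: "bij h" "\<And>x y. h (m (x, y)) = n (h x, h y)"
  shows "accepted n v = accepted m (inv h \<circ> v)"
proof -
  have v: "h \<circ> (inv h \<circ> v) = v"
    using h(1) by (auto simp: fun_eq_iff bij_is_surj surj_f_inv_f)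
  have "ev n v (query k) = h (ev m (inv h \<circ> v) (query k))" for k
    using ev_isomorphism[of h m n "query k" "inv h \<circ> v"] h(2) query_nonempty v by simp
  moreover have "h a = v b \<longleftrightarrow> a = inv h (v b)" for a b
    using h(1) by (metis bij_inv_eq_iff)
  ultimately show ?thesis
    by (simp add: accepted_def)
qed

theorem corollary4p3:
  shows "\<not> (\<exists>m. generic_semigroup m)"
proof
  let ?X = enumerated_semigroup_space
  assume "\<exists>m. generic_semigroup m"
  then obtain m \<N> where "countable \<N>" and nd: "\<And>N. N \<in> \<N> \<Longrightarrow> nowhere_dense_in ?X N"
    and cover: "enumerated_semigroups - {n \<in> enumerated_semigroups. semigroup_isomorphic m n} = \<Union>\<N>"
    unfolding generic_semigroup_def comeagre_in_def meagre_in_def by auto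
  obtain n0 v where n0: "n0 \<in> enumerated_semigroups" "satisfies n0 v"
    and v: "v (Fn (Halt True)) \<noteq> v (Fn (Halt False))"
    using machine_semigroup_exists .
  define \<G> where "\<G> = (\<lambda>N. ?X closure_of N) ` \<N> \<union> range (\<lambda>w. fibre v (accepted m w))"
  have "countable \<G>"
    unfolding \<G>_def using \<open>countable \<N>\<close> by auto
  moreover have "closedin ?X T \<and> ?X interior_of T = {}" if "T \<in> \<G>" for T
    using that nd closedin_fibre interior_fibre[OF v] by (auto simp: \<G>_def nowhere_dense_in_def)
  ultimately have empty: "?X interior_of \<Union>\<G> = {}"
    using completely_metrizable_enumerated_semigroup_space by (intro Baire_category_alt) auto
  have "{n \<in> enumerated_semigroups. satisfies n v} \<subseteq> \<Union>\<G>"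
  proof safe
    fix n assume n: "n \<in> enumerated_semigroups" "satisfies n v"
    show "n \<in> \<Union>\<G>"
    proof (cases "semigroup_isomorphic m n")
      case True
      then obtain h where "bij h" "\<And>x y. h (m (x, y)) = n (h x, h y)"
        unfolding semigroup_isomorphic_def by blast
      from accepted_isomorphic[of h m n, OF this] have "n \<in> fibre v (accepted m (inv h \<circ> v))"
        using n by (simp add: fibre_def)
      then show ?thesis unfolding \<G>_def by blast
    next
      case False
      with n cover obtain N where N: "N \<in> \<N>" "n \<in> N" by blast
      then have "N \<subseteq> ?X closure_of N"
        using nd by (intro closure_of_subset) (simp add: nowhere_dense_in_def)
      then show ?thesis using N unfolding \<G>_def by blast
    qed
  qed
  then have "{n \<in> enumerated_semigroups. satisfies n v} \<subseteq> ?X interior_of \<Union>\<G>"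
    using openin_satisfies by (rule interior_of_maximal)
  with n0 empty show False by auto
qed

end
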